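(* Let $1<p<\infty$, $-1<\alpha<\infty$, let $K\ge0$ be an integer, and let $f$ be analytic in $\mathbb{D}$ with $f, D_\theta^K f\in A^p_\alpha$. Let $\omega_{p,\alpha}(\delta)=\omega_{p,\alpha}(\delta,D_\theta^K f)$ be the $A^p_\alpha$ modulus of continuity of $D_\theta^K f$. Then for every integer $n\ge1$, $$E_n^{p,\alpha}(f)\le B_K\,\omega_{p,\alpha}\!\left(\frac{2\pi}{n}\right)n^{-K},\qquad B_K=\frac{2^K C_{K+1}}{\pi}+2^K C_K .$$
   Context: $\mathbb{D}$ is the open unit disc. For $1<p<\infty$, $\alpha>-1$, the weighted Bergman space $A^p_\alpha$ is the space of analytic functions $f$ in $\mathbb{D}$ with $\|f\|_{p,\alpha}=\left(\int_{\mathbb{D}}|f|^p\,dA_\alpha\right)^{1/p}<\infty$, where $dA_\alpha=(\alpha+1)\pi^{-1}(1-|z|^2)^\alpha\,dA(z)$ and $dA$ is Lebesgue area measure. $D_\theta^K f(re^{i\theta})=\frac{\partial^K}{\partial\theta^K}f(re^{i\theta})$. For $g\in A^p_\alpha$, $\omega_{p,\alpha}(\delta,g)=\sup_{|t|\le\delta}\|g(e^{it}\cdot)-g(\cdot)\|_{p,\alpha}$. $E_n^{p,\alpha}(f)=\min\{\|f-P\|_{p,\alpha}: P \text{ a polynomial of degree at most } n\}$. The constants are $C_k=\frac4\pi\int_0^\infty|H_k(t)|\,dt$, where $H_0(t)=h(t)/t^2$, $H_k(t)=\int_t^\infty H_{k-1}(x)\,dx$ for $k\ge1$, and $h(t)=(\cos(t)-\cos(2t))/2$.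 *)

theory Defs
  imports "HOL-Complex_Analysis.Complex_Analysis" "HOL-Computational_Algebra.Polynomial"
begin

definition bergman_measure :: "real \<Rightarrow> complex measure" where
  "bergman_measure \<alpha> =
     density (restrict_space lborel (ball 0 1))
       (\<lambda>z. ennreal ((\<alpha> + 1) / pi * (1 - (cmod z)\<^sup>2) powr \<alpha>))"

definition bergman_norm :: "real \<Rightarrow> real \<Rightarrow> (complex \<Rightarrow> complex) \<Rightarrow> real" where
  "bergman_norm p \<alpha> f = (\<integral>z. cmod (f z) powr p \<partial>bergman_measure \<alpha>) powr (1 / p)"

(* Elements are total functions; their values outside the unit disc are irrelevant. *)
definition bergman_space :: "real \<Rightarrow> real \<Rightarrow> (complex \<Rightarrow> complex) set" where
  "bergman_space p \<alpha> =
     {f. f holomorphic_on ball 0 1 \<and> integrable (bergman_measure \<alpha>) (\<lambda>z. cmod (f z) powr p)}"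

(* The K-th derivative of \<theta> \<mapsto> f (r e^(i\<theta>)), evaluated at the polar coordinates of z. *)
definition angular_deriv :: "nat \<Rightarrow> (complex \<Rightarrow> complex) \<Rightarrow> complex \<Rightarrow> complex" where
  "angular_deriv K f z =
     ((\<lambda>u \<theta>. vector_derivative u (at \<theta>)) ^^ K)
       (\<lambda>\<theta>::real. f (complex_of_real (cmod z) * cis \<theta>)) (Arg z)"

(* For g in the Bergman space and 1 < p the supremum is over a nonempty set bounded by
   2 * bergman_norm p \<alpha> g (rotation invariance and Minkowski). *)
definition bergman_modulus :: "real \<Rightarrow> real \<Rightarrow> real \<Rightarrow> (complex \<Rightarrow> complex) \<Rightarrow> real" where
  "bergman_modulus p \<alpha> \<delta> g =
     (SUP t\<in>{t. \<bar>t\<bar> \<le> \<delta>}. bergman_norm p \<alpha> (\<lambda>z. g (cis t * z) - g z))"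

(* The infimum is a minimum for f in the Bergman space: the polynomials of degree at most n
   form a finite-dimensional subspace. *)
definition best_approx :: "real \<Rightarrow> real \<Rightarrow> nat \<Rightarrow> (complex \<Rightarrow> complex) \<Rightarrow> real" where
  "best_approx p \<alpha> n f =
     (INF P\<in>{P :: complex poly. degree P \<le> n}. bergman_norm p \<alpha> (\<lambda>z. f z - poly P z))"

(* The value of H 0 at t = 0, where division by zero yields 0, does not affect the integrals.
   Since H k t = O(1/t^2) for every k, all integrals below converge absolutely. *)
primrec H :: "nat \<Rightarrow> real \<Rightarrow> real" where
  "H 0 = (\<lambda>t. ((cos t - cos (2 * t)) / 2) / t\<^sup>2)"
| "H (Suc k) = (\<lambda>t. LINT x:{t..}|lborel. H k x)"

definition C :: "nat \<Rightarrow> real" where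
  "C k = 4 / pi * (LINT t:{0..}|lborel. \<bar>H k t\<bar>)"

definition B :: "nat \<Rightarrow> real" where
  "B K = 2 ^ K * C (K + 1) / pi + 2 ^ K * C K"

end

theory Submission
  imports Defs "HOL-Probability.Sinc_Integral" "HOL-Real_Asymp.Real_Asymp"
begin

text \<open>
  Put \<open>c = 2/n\<close>, \<open>\<delta> = 2\<pi>/n\<close>, \<open>g = D\<^sub>\<theta>\<^sup>K f\<close>, and let \<open>\<phi>\<close> be \<open>4/\<pi>\<close> times the cosine transform of \<open>H\<^sub>0\<close>
  on the half line. It is the de la Vallee-Poussin multiplier: \<open>1\<close> on \<open>[0, 1]\<close>, \<open>0\<close> on \<open>[2, \<infinity>)\<close>
  and linear in between, so multiplying the m-th Taylor coefficient by \<open>\<phi>(cm)\<close> yields a polynomial of degree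
  below n. Integrating by parts k times turns \<open>1 - \<phi>(cm)\<close> into a multiple of \<open>(icm)\<^sup>k\<close> times the transform of \<open>H\<^sub>k\<close>;
  the boundary terms vanish because \<open>\<phi>\<close> is constant near \<open>0\<close>. So the error of this approximation to
  a function \<open>u\<close> is an average of rotations of \<open>D\<^sub>\<theta>\<^sup>k u\<close> and has norm at most \<open>c\<^sup>k C\<^sub>k \<parallel>D\<^sub>\<theta>\<^sup>k u\<parallel>\<close>.
  Split \<open>f\<close> into its mean over rotations by angles in \<open>[0, \<delta>]\<close> and the remainder: the
  \<open>(K+1)\<close>-st angular derivative of the mean is \<open>(g(e\<^sup>i\<^sup>\<delta>z) - g(z))/\<delta>\<close>, of norm at most \<open>\<omega>(\<delta>)/\<delta>\<close>, and the
  \<open>K\<close>-th angular derivative of the remainder has norm at most \<open>\<omega>(\<delta>)\<close>. For \<open>K = 0\<close> the remainder is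
  approximated by \<open>0\<close>, which suffices as \<open>C\<^sub>0 \<ge> 1\<close>.
\<close>

section \<open>Tail integrals\<close>

lemma set_integral_Ioi_eq_Ici:
  fixes f :: "real \<Rightarrow> 'a::{banach, second_countable_topology}"
  assumes "set_integrable lborel {a..} f"
  shows "(LINT x:{a<..}|lborel. f x) = (LINT x:{a..}|lborel. f x)"
proof -
  have "set_integrable lborel {a<..} f"
    using assms by (rule set_integrable_subset) auto
  with assms have m: "(\<lambda>x. indicator {a<..} x *\<^sub>R f x) \<in> borel_measurable lborel"
      "(\<lambda>x. indicator {a..} x *\<^sub>R f x) \<in> borel_measurable lborel"
    unfolding set_integrable_def by auto
  have "AE x in lborel. indicator {a<..} x *\<^sub>R f x = indicator {a..} x *\<^sub>R f x"
    using AE_lborel_singleton[of a]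
  proof eventually_elim
    case (elim x)
    then have "x \<in> {a<..} \<longleftrightarrow> x \<in> {a..}" by auto
    then show ?case by (simp add: indicator_def)
  qed
  then show ?thesis
    unfolding set_lebesgue_integral_def by (rule integral_cong_AE[OF m])
qed

text \<open>Regularity of the integrand is asked only to the right of \<open>a\<close>: at 0 the
  kernel \<open>H 0\<close> jumps, since its value there is 0 by the division convention while its
  limit is 3/4. Continuity of \<open>F\<close> on the closed half line supplies the boundary
  value.\<close>

lemma FTC_atLeast:
  fixes f F :: "real \<Rightarrow> 'a::euclidean_space"
  assumes cont: "continuous_on {a..} F"
    and deriv: "\<And>x. a < x \<Longrightarrow> (F has_vector_derivative f x) (at x)"
    and contf: "\<And>x. a < x \<Longrightarrow> isCont f x"
    and int: "set_integrable lborel {a..} f"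
    and lim: "(F \<longlongrightarrow> L) at_top"
  shows "(LINT x:{a..}|lborel. f x) = L - F a"
proof -
  have [simp]: "einterval (ereal a) \<infinity> = {a<..}"
    by (auto simp: einterval_def)
  have "(LINT x:{a..}|lborel. f x) = (LINT x:{a<..}|lborel. f x)"
    by (rule set_integral_Ioi_eq_Ici[OF int, symmetric])
  also have "\<dots> = (LBINT x=ereal a..\<infinity>. f x)"
    by (simp add: interval_lebesgue_integral_def)
  also have "\<dots> = L - F a"
  proof (rule interval_integral_FTC_integrable[where F = F])
    show "set_integrable lborel (einterval (ereal a) \<infinity>) f"
      using int by (rule set_integrable_subset) auto
    have "(F \<longlongrightarrow> F a) (at a within {a..})"
      using cont by (auto simp: continuous_on_def)
    then show "((F \<circ> real_of_ereal) \<longlongrightarrow> F a) (at_right (ereal a))"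
      by (simp add: ereal_tendsto_simps at_within_Ici_at_right)
    show "((F \<circ> real_of_ereal) \<longlongrightarrow> L) (at_left \<infinity>)"
      using lim by (simp add: ereal_tendsto_simps)
  qed (use deriv contf in auto)
  finally show ?thesis .
qed

lemma tail_integral_split:
  fixes f :: "real \<Rightarrow> 'a::euclidean_space"
  assumes int: "set_integrable lborel {a..} f" and "a \<le> t"
  shows "(LINT x:{t..}|lborel. f x) = (LINT x:{a..}|lborel. f x) - integral {a..t} f"
proof -
  have i1: "set_integrable lborel {a..t} f"
    using int by (rule set_integrable_subset) auto
  have i2: "set_integrable lborel {t<..} f"
    using int by (rule set_integrable_subset) (use assms in auto)
  have i3: "set_integrable lborel {t..} f"
    using int by (rule set_integrable_subset) (use assms in auto)
  have "{a..} = {a..t} \<union> {t<..}" using assms by auto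
  then have "(LINT x:{a..}|lborel. f x) = (LINT x:{a..t}|lborel. f x) + (LINT x:{t<..}|lborel. f x)"
    using set_integral_Un[OF _ i1 i2] by (auto simp: disjoint_iff)
  moreover have "(LINT x:{t<..}|lborel. f x) = (LINT x:{t..}|lborel. f x)"
    by (rule set_integral_Ioi_eq_Ici[OF i3])
  ultimately show ?thesis
    using set_borel_integral_eq_integral(2)[OF i1] by simp
qed

text \<open>By \<open>tail_integral_split\<close> a tail is a constant minus an indefinite integral,
  so the standard facts on indefinite integrals carry over. They become the calculus of
  \<open>H (Suc k)\<close>.\<close>

lemma
  fixes f :: "real \<Rightarrow> 'a::euclidean_space"
  assumes int: "set_integrable lborel {a..} f"
  shows continuous_on_tail_integral:
      "continuous_on {a..} (\<lambda>t. LINT x:{t..}|lborel. f x)"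
    and tail_integral_has_vector_derivative:
      "a < t \<Longrightarrow> isCont f t \<Longrightarrow>
        ((\<lambda>t. LINT x:{t..}|lborel. f x) has_vector_derivative - f t) (at t)"
    and tail_integral_at_top: "((\<lambda>t. LINT x:{t..}|lborel. f x) \<longlongrightarrow> 0) at_top"
proof -
  let ?G = "\<lambda>t. LINT x:{t..}|lborel. f x"
  have hk: "f integrable_on {a..b}" for b
    by (rule set_borel_integral_eq_integral(1)) (rule set_integrable_subset[OF int], auto)
  have G: "?G t = ?G a - integral {a..t} f" if "a \<le> t" for t
    using tail_integral_split[OF int that] .
  have c: "continuous_on {a..b} (\<lambda>t. integral {a..t} f)" for b
    by (rule indefinite_integral_continuous_1[OF hk])
  have c': "continuous_on {a..} (\<lambda>t. integral {a..t} f)"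
    unfolding continuous_on_eq_continuous_within
  proof
    fix x assume "x \<in> {a..}"
    \<comment> \<open>Continuity is known on compact intervals, and near \<open>x\<close> the half
      line coincides with \<open>{a..x+1}\<close>.\<close>
    then have "continuous (at x within {a..x+1}) (\<lambda>t. integral {a..t} f)"
      using c[of "x+1"] by (auto simp: continuous_on_eq_continuous_within)
    moreover have "at x within {a..x+1} = at x within {a..}"
      by (rule at_within_nhd[of x "{..<x+1}"]) auto
    ultimately show "continuous (at x within {a..}) (\<lambda>t. integral {a..t} f)" by simp
  qed
  show "continuous_on {a..} ?G"
    by (rule continuous_on_eq[of _ "\<lambda>t. ?G a - integral {a..t} f"])
       (use G[symmetric] c' in \<open>auto intro!: continuous_intros\<close>)
  show "(?G has_vector_derivative - f t) (at t)" if "a < t" "isCont f t"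
  proof -
    have "((\<lambda>u. integral {a..u} f) has_vector_derivative f t) (at t within {a..t+1})"
      using integral_has_vector_derivative_continuous_at[OF hk, of t "t+1" "{}"] that
      by (auto intro: continuous_at_imp_continuous_at_within)
    moreover have "at t within {a..t+1} = at t"
      by (rule at_within_interior) (use that in auto)
    ultimately have "((\<lambda>u. ?G a - integral {a..u} f) has_vector_derivative - f t) (at t)"
      by (auto intro!: derivative_eq_intros)
    then show ?thesis
      by (rule has_vector_derivative_transform_within_open[of _ _ _ "{a<..}"])
         (use that G[symmetric] in auto)
  qed
  have "((\<lambda>b. LINT x:{a..b}|lborel. f x) \<longlongrightarrow> ?G a) at_top"
    by (rule tendsto_set_lebesgue_integral_at_top[OF _ int]) auto
  then have "((\<lambda>b. ?G a - (LINT x:{a..b}|lborel. f x)) \<longlongrightarrow> ?G a - ?G a) at_top"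
    by (intro tendsto_intros)
  moreover have "eventually (\<lambda>b. ?G a - (LINT x:{a..b}|lborel. f x) = ?G b) at_top"
    using eventually_ge_at_top[of a]
  proof eventually_elim
    case (elim b)
    have "set_integrable lborel {a..b} f" by (rule set_integrable_subset[OF int]) auto
    then show ?case using G[OF elim] set_borel_integral_eq_integral(2)[of "{a..b}" f] by simp
  qed
  ultimately show "(?G \<longlongrightarrow> 0) at_top"
    by (simp add: Lim_transform_eventually)
qed

lemma
  fixes t :: real
  assumes "1 \<le> t"
  shows set_integrable_inverse_power: "set_integrable lborel {t..} (\<lambda>x. 1 / x ^ (r + 2))"
    and set_integral_inverse_power:
      "(LINT x:{t..}|lborel. 1 / x ^ (r + 2)) = 1 / (real (r + 1) * t ^ (r + 1))"
proof -
  let ?F = "\<lambda>x::real. - 1 / (real (r + 1) * x ^ (r + 1))"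
  have e: "einterval (ereal t) \<infinity> = {t<..}"
    by (auto simp: einterval_def)
  have D: "(?F has_real_derivative 1 / x ^ (r + 2)) (at x)" if "t < x" for x
  proof -
    have x: "x > 0" using that assms by simp
    show ?thesis
    proof (rule DERIV_cong)
      have "((\<lambda>x. - 1 / real (r + 1) * inverse x ^ Suc r) has_real_derivative
          - 1 / real (r + 1) * (real (Suc r) * (- (inverse x ^ Suc (Suc 0)) * inverse x ^ r))) (at x)"
        using DERIV_power[OF DERIV_inverse, where x=x and n="Suc r" and s=UNIV] x
        by (intro DERIV_cmult) (simp add: mult_ac)
      then show "(?F has_real_derivative
          - 1 / real (r + 1) * (real (Suc r) * (- (inverse x ^ Suc (Suc 0)) * inverse x ^ r))) (at x)"
        by (simp add: field_simps)
    qed (use x in \<open>simp add: field_simps\<close>)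
  qed
  have c: "isCont (\<lambda>x::real. 1 / x ^ (r + 2)) x" if "t < x" for x
    using that assms by (auto intro!: continuous_intros)
  have A: "((?F \<circ> real_of_ereal) \<longlongrightarrow> ?F t) (at_right (ereal t))"
    unfolding ereal_tendsto_simps
    using assms by (auto intro!: tendsto_intros)
  have "((\<lambda>x::real. 1 / (real (r + 1)) * inverse (x ^ (r+1))) \<longlongrightarrow> 1 / real (r+1) * 0) at_top"
    by (intro tendsto_mult tendsto_const tendsto_inverse_0_at_top filterlim_pow_at_top filterlim_ident) auto
  from tendsto_minus[OF this] have B: "((?F \<circ> real_of_ereal) \<longlongrightarrow> 0) (at_left \<infinity>)"
    unfolding ereal_tendsto_simps by (simp add: field_simps)
  \<comment> \<open>The version for nonnegative integrands yields integrability; the value is then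
    read off from \<open>FTC_atLeast\<close>, which presupposes it.\<close>
  note F = interval_integral_FTC_nonneg[OF _ _ _ _ A B, of "\<lambda>x. 1 / x ^ (r + 2)"]
  have "set_integrable lborel {t<..} (\<lambda>x::real. 1 / x ^ (r + 2))"
    using F(1) D c assms by (auto simp: e)
  then show I: "set_integrable lborel {t..} (\<lambda>x. 1 / x ^ (r + 2))"
    unfolding set_integrable_def
    by (rule integrable_cong_AE_imp)
       (measurable, use AE_lborel_singleton[of t] in \<open>auto elim!: eventually_mono simp: indicator_def\<close>)
  have contF: "continuous_on {t..} ?F"
    using assms by (intro continuous_intros) (auto simp del: of_nat_add of_nat_Suc)
  have "(LINT x:{t..}|lborel. 1 / x ^ (r + 2)) = 0 - ?F t"
    by (rule FTC_atLeast[OF contF D[unfolded has_real_derivative_iff_has_vector_derivative]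
          c I B[unfolded ereal_tendsto_simps]])
  then show "(LINT x:{t..}|lborel. 1 / x ^ (r + 2)) = 1 / (real (r + 1) * t ^ (r + 1))"
    by simp
qed

text \<open>Comparison with \<open>1 / x ^ (r + 2)\<close>, integrable for every natural
  \<open>r\<close>. Integration costs one power of \<open>t\<close>, and the gained factor 1/(r+1)
  is estimated by 1.\<close>

lemma set_integrable_power_decay:
  fixes f :: "real \<Rightarrow> 'a::euclidean_space"
  assumes "continuous_on {1..} f" and "\<And>t. t \<ge> 1 \<Longrightarrow> norm (f t) \<le> M / t ^ (r + 2)" and "1 \<le> t"
  shows "set_integrable lborel {t..} f"
    and "norm (LINT x:{t..}|lborel. f x) \<le> M / t ^ (r + 1)"
proof -
  have I: "set_integrable lborel {t..} (\<lambda>x. M * (1 / x ^ (r + 2)))"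
    using set_integrable_inverse_power[OF assms(3)] by (rule set_integrable_mult_right)
  have m: "(\<lambda>x. indicator {t..} x *\<^sub>R f x) \<in> borel_measurable lborel"
    using assms by (auto intro!: borel_measurable_continuous_on_indicator intro: continuous_on_subset)
  show J: "set_integrable lborel {t..} f"
    using I unfolding set_integrable_def
    by (rule Bochner_Integration.integrable_bound)
       (use m order_trans[OF assms(2) abs_ge_self] assms(3) in \<open>auto simp: indicator_def intro!: AE_I2\<close>)
  have "norm (LINT x:{t..}|lborel. f x) \<le> (LINT x:{t..}|lborel. norm (f x))"
    by (rule set_integral_norm_bound[OF J])
  also have "\<dots> \<le> (LINT x:{t..}|lborel. M * (1 / x ^ (r + 2)))"
    by (rule set_integral_mono[OF set_integrable_norm[OF J] I]) (use assms in auto)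
  also have "\<dots> = M * (1 / (real (r + 1) * t ^ (r + 1)))"
    unfolding set_integral_mult_right set_integral_inverse_power[OF assms(3)] ..
  also have "\<dots> \<le> M * (1 / (1 * t ^ (r + 1)))"
  proof (intro mult_left_mono divide_left_mono mult_right_mono)
    show "0 \<le> M" using order_trans[OF norm_ge_zero assms(2)[of 1]] by simp
  qed (use assms in auto)
  finally show "norm (LINT x:{t..}|lborel. f x) \<le> M / t ^ (r + 1)" by simp
qed

section \<open>The kernels and their Fourier transforms\<close>

lemma isCont_cis [continuous_intros]: "isCont (\<lambda>t::real. cis (x * t)) t"
  unfolding cis_conv_exp by (intro continuous_intros)

lemma cis_has_vector_derivative: "((\<lambda>t. cis (x * t)) has_vector_derivative \<i> * x * cis (x * t)) (at t)"
proof -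
  have "((\<lambda>z. exp (\<i> * x * z)) has_field_derivative \<i> * x * exp (\<i> * x * of_real t)) (at (of_real t))"
    by (auto intro!: derivative_eq_intros)
  then have "((\<lambda>t. exp (\<i> * x * of_real t)) has_vector_derivative \<i> * x * exp (\<i> * x * of_real t)) (at t)"
    by (rule has_vector_derivative_real_field)
  then show ?thesis by (simp add: cis_conv_exp mult_ac)
qed

lemma measurable_cis_mult [measurable]: "(\<lambda>t::real. cis (x * t)) \<in> borel_measurable borel"
  by (intro borel_measurable_continuous_onI continuous_at_imp_continuous_on ballI isCont_cis)

text \<open>The shift by 2 makes every \<open>r\<close> imply integrability at infinity. Starting at
  1 stays away from the singularity of \<open>osc\<close> at 0.\<close>

definition decays :: "nat \<Rightarrow> (real \<Rightarrow> complex) \<Rightarrow> bool" where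
  "decays r g \<longleftrightarrow> continuous_on {1..} g \<and> (\<exists>M. \<forall>t\<ge>1. norm (g t) \<le> M / t ^ (r + 2))"

text \<open>The recursion of \<open>H\<close> with a free complex starting function, so that it can
  be run on each frequency separately.\<close>

primrec tails :: "nat \<Rightarrow> (real \<Rightarrow> complex) \<Rightarrow> real \<Rightarrow> complex" where
  "tails 0 g = g"
| "tails (Suc k) g = (\<lambda>t. LINT x:{t..}|lborel. tails k g x)"

lemma decays_integrable:
  assumes "decays r g" "1 \<le> t"
  shows "set_integrable lborel {t..} g"
  using assms set_integrable_power_decay(1) unfolding decays_def by blast

lemma decays_tail:
  assumes "decays r g"
  shows "continuous_on {1..} (\<lambda>t. LINT x:{t..}|lborel. g x)"
    and "\<exists>M. \<forall>t\<ge>1. norm (LINT x:{t..}|lborel. g x) \<le> M / t ^ (r + 1)"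
  using continuous_on_tail_integral[OF decays_integrable[OF assms order_refl]]
    set_integrable_power_decay(2) assms unfolding decays_def by blast+

text \<open>\<open>H 0\<close> is the real part of half the difference of \<open>osc 1 0\<close> and
  \<open>osc 2 0\<close>. Larger \<open>r\<close> enter because integration by parts raises the
  exponent.\<close>

definition osc :: "real \<Rightarrow> nat \<Rightarrow> real \<Rightarrow> complex" where
  "osc a r t = cis (a * t) / complex_of_real t ^ (r + 2)"

lemma decays_osc: "decays r (osc a r)"
proof -
  have "continuous_on {1..} (osc a r)"
    unfolding osc_def by (intro continuous_intros) auto
  then show ?thesis
    unfolding decays_def by (auto simp: osc_def norm_divide norm_mult norm_power intro!: exI[of _ 1])
qed

lemma osc_has_vector_derivative:
  assumes "t > 0"
  shows "(osc a r has_vector_derivative \<i> * a * osc a r t - of_nat (r + 2) * osc a (Suc r) t) (at t)"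
proof -
  have "((\<lambda>t. inverse t ^ (r + 2)) has_real_derivative
      real (r + 2) * (- (inverse t ^ Suc (Suc 0)) * inverse t ^ (r + 2 - Suc 0))) (at t)"
    by (rule DERIV_power[OF DERIV_inverse]) (use assms in auto)
  then have "((\<lambda>t. complex_of_real (inverse t ^ (r + 2))) has_vector_derivative
      complex_of_real (real (r + 2) * (- (inverse t ^ Suc (Suc 0)) * inverse t ^ (r + 2 - Suc 0)))) (at t)"
    by (intro has_vector_derivative_of_real) (simp add: has_real_derivative_iff_has_vector_derivative)
  from has_vector_derivative_mult[OF cis_has_vector_derivative[of a t] this] show ?thesis
    using assms
    by (auto simp: osc_def[abs_def] scaleR_conv_of_real divide_inverse power_inverse mult_ac algebra_simps
        elim!: back_subst[of "\<lambda>D. (_ has_vector_derivative D) _"])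
qed

text \<open>The derivative of \<open>osc a r\<close> is integrated from \<open>t\<close> to
  infinity, where \<open>osc a r\<close> tends to 0; the result is solved for the slowly decaying
  term, dividing by the nonzero frequency.\<close>

lemma tail_osc:
  assumes "a \<noteq> 0" "t \<ge> 1"
  shows "tails (Suc 0) (osc a r) t
    = (of_nat (r + 2) * tails (Suc 0) (osc a (Suc r)) t - osc a r t) / (\<i> * a)"
proof -
  have I: "set_integrable lborel {t..} (osc a s)" for s
    using decays_integrable[OF decays_osc assms(2)] .
  have lim: "(osc a r \<longlongrightarrow> 0) at_top"
  proof (rule Lim_null_comparison)
    show "\<forall>\<^sub>F x in at_top. norm (osc a r x) \<le> inverse (x ^ (r + 2))"
      using eventually_gt_at_top[of 0]
      by eventually_elim (auto simp: osc_def norm_divide norm_mult norm_power inverse_eq_divide)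
    show "((\<lambda>x::real. inverse (x ^ (r + 2))) \<longlongrightarrow> 0) at_top"
      by (intro tendsto_inverse_0_at_top filterlim_pow_at_top filterlim_ident) auto
  qed
  have c: "isCont (osc a s) x" if "t < x" for s x
    by (rule has_vector_derivative_continuous[OF osc_has_vector_derivative]) (use that assms in auto)
  have "(LINT x:{t..}|lborel. \<i> * a * osc a r x - of_nat (r + 2) * osc a (Suc r) x) = 0 - osc a r t"
  proof (rule FTC_atLeast[OF _ osc_has_vector_derivative _ _ lim])
    show "continuous_on {t..} (osc a r)"
      using decays_osc[of r a] assms unfolding decays_def by (auto intro: continuous_on_subset)
    show "set_integrable lborel {t..} (\<lambda>x. \<i> * a * osc a r x - of_nat (r + 2) * osc a (Suc r) x)"
      by (intro set_integral_diff(1) set_integrable_mult_right I)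
    show "isCont (\<lambda>x. \<i> * a * osc a r x - of_nat (r + 2) * osc a (Suc r) x) x" if "t < x" for x
      using c[OF that] by (intro continuous_intros)
  qed (use assms in auto)
  moreover have "(LINT x:{t..}|lborel. \<i> * a * osc a r x - of_nat (r + 2) * osc a (Suc r) x)
      = \<i> * a * tails (Suc 0) (osc a r) t - of_nat (r + 2) * tails (Suc 0) (osc a (Suc r)) t"
    by (subst set_integral_diff(2)) (auto intro!: set_integrable_mult_right I)
  ultimately show ?thesis
    using assms(1) by (simp add: field_simps)
qed

text \<open>
  Each tail integration loses a power of \<open>t\<close>. Integration by parts gains it back, since it expresses
  \<open>tails (k + 1) (osc a r)\<close> through the faster decaying \<open>tails (k + 1) (osc a (r + 1))\<close>.
\<close>

lemma tails_osc:
  assumes "a \<noteq> 0"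
  shows "(\<forall>r. decays r (tails k (osc a r))) \<and>
    (\<forall>r. \<forall>t\<ge>1. tails (Suc k) (osc a r) t
      = (of_nat (r + 2) * tails (Suc k) (osc a (Suc r)) t - tails k (osc a r) t) / (\<i> * a))"
proof (induction k)
  case 0
  show ?case
    unfolding tails.simps(1)[of "osc a _"] by (intro conjI allI impI decays_osc tail_osc[OF assms])
next
  case (Suc k)
  have D: "decays r (tails k (osc a r))" for r using Suc by blast
  have R: "tails (Suc k) (osc a r) t
      = (of_nat (r + 2) * tails (Suc k) (osc a (Suc r)) t - tails k (osc a r) t) / (\<i> * a)"
    if "t \<ge> 1" for r t using Suc that by blast
  have D': "decays r (tails (Suc k) (osc a r))" for r
  proof -
    \<comment> \<open>Both terms of the recursion have the wanted exponent \<open>r + 2\<close>: the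
      first by induction, the second because it starts from index \<open>Suc r\<close> and loses one
      power.\<close>
    obtain M1 where M1: "\<And>t. t \<ge> 1 \<Longrightarrow> norm (tails k (osc a r) t) \<le> M1 / t ^ (r + 2)"
      using D[of r] unfolding decays_def by blast
    obtain M2 where M2: "\<And>t. t \<ge> 1 \<Longrightarrow> norm (tails (Suc k) (osc a (Suc r)) t) \<le> M2 / t ^ (r + 2)"
      using decays_tail(2)[OF D[of "Suc r"]] by auto
    have "norm (tails (Suc k) (osc a r) t) \<le> ((real (r + 2) * M2 + M1) / \<bar>a\<bar>) / t ^ (r + 2)"
      if t: "t \<ge> 1" for t
    proof -
      have "norm (tails (Suc k) (osc a r) t)
          = norm (of_nat (r + 2) * tails (Suc k) (osc a (Suc r)) t - tails k (osc a r) t) / \<bar>a\<bar>"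
        unfolding R[OF t, of r] by (simp add: norm_divide norm_mult del: tails.simps)
      also have "\<dots> \<le> (real (r + 2) * norm (tails (Suc k) (osc a (Suc r)) t) + norm (tails k (osc a r) t)) / \<bar>a\<bar>"
        by (intro divide_right_mono order_trans[OF norm_triangle_ineq4])
           (simp_all only: norm_mult norm_of_nat order_refl abs_ge_zero)
      also have "\<dots> \<le> (real (r + 2) * (M2 / t ^ (r + 2)) + M1 / t ^ (r + 2)) / \<bar>a\<bar>"
        by (intro divide_right_mono add_mono mult_left_mono M1 M2 t) auto
      finally show ?thesis by (simp add: add_divide_distrib mult_ac)
    qed
    then have "\<exists>M. \<forall>t\<ge>1. norm (tails (Suc k) (osc a r) t) \<le> M / t ^ (r + 2)" by blast
    then show ?thesis
      using decays_tail(1)[OF D[of r]] unfolding decays_def by (simp only: tails.simps(2) simp_thms)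
  qed
  moreover have "tails (Suc (Suc k)) (osc a r) t
      = (of_nat (r + 2) * tails (Suc (Suc k)) (osc a (Suc r)) t - tails (Suc k) (osc a r) t) / (\<i> * a)"
    if t: "t \<ge> 1" for r t
  proof -
    \<comment> \<open>The recursion at level \<open>k\<close> is integrated over the half line; the
      decay just proved for level \<open>Suc k\<close> makes the pieces separately
      integrable.\<close>
    have "tails (Suc (Suc k)) (osc a r) t = (LINT x:{t..}|lborel. tails (Suc k) (osc a r) x)"
      by simp
    also have "\<dots> = (LINT x:{t..}|lborel.
        (of_nat (r + 2) * tails (Suc k) (osc a (Suc r)) x - tails k (osc a r) x) / (\<i> * a))"
      by (rule set_lebesgue_integral_cong, simp, intro allI impI R) (use t in auto)
    also have "\<dots> = (of_nat (r + 2) * (LINT x:{t..}|lborel. tails (Suc k) (osc a (Suc r)) x)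
        - (LINT x:{t..}|lborel. tails k (osc a r) x)) / (\<i> * a)"
      using decays_integrable[OF D'[of "Suc r"] t] decays_integrable[OF D[of r] t]
      by (simp add: set_integral_diff(2) set_integrable_mult_right del: tails.simps of_nat_add)
    finally show ?thesis by simp
  qed
  ultimately show ?case by blast
qed

section \<open>Integrability and cosine transform of the kernels\<close>

lemma set_integral_Re:
  fixes f :: "'a \<Rightarrow> complex"
  assumes "set_integrable M A f"
  shows "set_integrable M A (\<lambda>x. Re (f x))" and "(LINT x:A|M. Re (f x)) = Re (LINT x:A|M. f x)"
  using integrable_Re[OF assms[unfolded set_integrable_def]] integral_Re[OF assms[unfolded set_integrable_def]]
  unfolding set_integrable_def set_lebesgue_integral_def by simp_all

text \<open>Estimating absolute values would leave only O(1/t) for \<open>H 1\<close>, which is not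
  integrable. The complex tails retain the oscillation that \<open>tails_osc\<close>
  exploits.\<close>

lemma H_eq_Re_tails:
  assumes "t \<ge> 1"
  shows "H k t = Re ((tails k (osc 1 0) t - tails k (osc 2 0) t) / 2)"
  using assms
proof (induction k arbitrary: t)
  case 0
  have "Re (cis (a * t) / complex_of_real t ^ 2) = cos (a * t) / t\<^sup>2" for a
    by (metis Re_divide_of_real cis.sel(1) of_real_power)
  then show ?case by (simp add: osc_def[abs_def] power2_eq_square diff_divide_distrib del: Re_divide_of_real)
next
  case (Suc k)
  have I: "set_integrable lborel {t..} (tails k (osc a 0))" if "a \<noteq> 0" for a
    using tails_osc[OF that, of k] decays_integrable Suc.prems by blast
  have "H (Suc k) t = (LINT x:{t..}|lborel. Re ((tails k (osc 1 0) x - tails k (osc 2 0) x) / 2))"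
    by (simp only: H.simps) (rule set_lebesgue_integral_cong, use Suc in auto)
  also have "\<dots> = Re (LINT x:{t..}|lborel. (tails k (osc 1 0) x - tails k (osc 2 0) x) / 2)"
    by (rule set_integral_Re(2)) (intro set_integrable_divide set_integral_diff(1) I, auto)
  also have "(LINT x:{t..}|lborel. (tails k (osc 1 0) x - tails k (osc 2 0) x) / 2)
      = (tails (Suc k) (osc 1 0) t - tails (Suc k) (osc 2 0) t) / 2"
    by (simp add: set_integral_diff(2)[OF I I])
  finally show ?case .
qed

lemma set_integrable_H_1: "set_integrable lborel {1..} (H k)"
proof -
  have I: "set_integrable lborel {1..} (tails k (osc a 0))" if "a \<noteq> 0" for a
    using tails_osc[OF that, of k] decays_integrable by blast
  have "set_integrable lborel {1..} (\<lambda>t. Re ((tails k (osc 1 0) t - tails k (osc 2 0) t) / 2))"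
    by (intro set_integral_Re(1) set_integrable_divide set_integral_diff(1) I) auto
  then show ?thesis
    by (subst set_integrable_cong[OF refl refl H_eq_Re_tails]) auto
qed

text \<open>For a > 0 the function a Si(at) - (1 - cos(at))/t is an antiderivative; it tends to 0 at
  0 and to a pi/2 at infinity. Negative \<open>a\<close> follows as cosine is even.\<close>

lemma
  fixes a :: real
  shows set_integrable_one_minus_cos: "set_integrable lborel {0..} (\<lambda>t. (1 - cos (a * t)) / t\<^sup>2)"
    and set_integral_one_minus_cos: "(LINT t:{0..}|lborel. (1 - cos (a * t)) / t\<^sup>2) = pi / 2 * \<bar>a\<bar>"
proof -
  let ?q = "\<lambda>a t::real. (1 - cos (a * t)) / t\<^sup>2"
  have pos: "set_integrable lborel {0..} (?q a) \<and> (LINT t:{0..}|lborel. ?q a t) = pi / 2 * a"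
    if a: "a > 0" for a
  proof -
    let ?F = "\<lambda>t. a * Si (a * t) - (1 - cos (a * t)) / t"
    have e: "einterval 0 \<infinity> = {0::real<..}"
      by (auto simp: einterval_def zero_ereal_def)
    have D: "(?F has_real_derivative ?q a t) (at t)" if t: "t > 0" for t
    proof -
      have "((\<lambda>t. Si (a * t)) has_real_derivative (sin (a * t) / (a * t)) * a) (at t)"
        using DERIV_chain2[OF DERIV_Si, of "\<lambda>t. a * t" a t UNIV] t a
        by (auto intro!: derivative_eq_intros)
      then show ?thesis
        using t a by (auto intro!: derivative_eq_intros simp: field_simps power2_eq_square)
    qed
    have c: "isCont (?q a) t" if "t > 0" for t
      using that by (auto intro!: continuous_intros)
    have "((\<lambda>t. (1 - cos (a * t)) / t) \<longlongrightarrow> 0) (at_right 0)"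
      using a by real_asymp
    moreover have "((\<lambda>t. a * Si (a * t)) \<longlongrightarrow> a * Si (a * 0)) (at_right 0)"
      by (intro tendsto_intros isCont_tendsto_compose[OF isCont_Si])
    ultimately have "(?F \<longlongrightarrow> a * Si (a * 0) - 0) (at_right 0)"
      by (intro tendsto_diff)
    moreover have "Si 0 = 0" by (simp add: Si_def zero_ereal_def[symmetric])
    ultimately have A: "((?F \<circ> real_of_ereal) \<longlongrightarrow> 0) (at_right 0)"
      by (simp add: ereal_tendsto_simps zero_ereal_def)
    have "((\<lambda>t. (1 - cos (a * t)) / t) \<longlongrightarrow> 0) at_top"
    proof (rule Lim_null_comparison)
      show "\<forall>\<^sub>F t in at_top. norm ((1 - cos (a * t)) / t) \<le> 2 / t"
        using eventually_gt_at_top[of 0]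
      proof eventually_elim
        case (elim t)
        have "\<bar>1 - cos (a * t)\<bar> \<le> 2" using cos_le_one[of "a*t"] cos_ge_minus_one[of "a*t"] by linarith
        then show ?case using elim by (auto simp: divide_right_mono)
      qed
      show "((\<lambda>t::real. 2 / t) \<longlongrightarrow> 0) at_top" by real_asymp
    qed
    moreover have "((\<lambda>t. a * Si (a * t)) \<longlongrightarrow> a * (pi / 2)) at_top"
      by (intro tendsto_intros filterlim_compose[OF Si_at_top]
          filterlim_tendsto_pos_mult_at_top[OF tendsto_const a filterlim_ident])
    ultimately have "(?F \<longlongrightarrow> a * (pi / 2) - 0) at_top"
      by (intro tendsto_diff)
    then have B: "((?F \<circ> real_of_ereal) \<longlongrightarrow> pi / 2 * a) (at_left \<infinity>)"
      by (simp add: ereal_tendsto_simps mult_ac)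
    have F: "set_integrable lborel (einterval 0 \<infinity>) (?q a)" "(LBINT t=0..\<infinity>. ?q a t) = pi / 2 * a - 0"
      by (rule interval_integral_FTC_nonneg[OF _ D c _ A B]; simp add: zero_ereal_def)+
    have I: "set_integrable lborel {0..} (?q a)"
      using F(1) unfolding set_integrable_def
      by (rule integrable_cong_AE_imp)
         (measurable, use AE_lborel_singleton[of 0] in \<open>auto elim!: eventually_mono simp: indicator_def e\<close>)
    have "(LINT t:{0..}|lborel. ?q a t) = pi / 2 * a"
      unfolding set_integral_Ioi_eq_Ici[OF I, symmetric]
      using F(2) by (simp add: interval_lebesgue_integral_def e)
    with I show ?thesis by simp
  qed
  have "set_integrable lborel {0..} (?q a) \<and> (LINT t:{0..}|lborel. ?q a t) = pi / 2 * \<bar>a\<bar>"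
  proof (cases a "0::real" rule: linorder_cases)
    case less
    with pos[of "-a"] show ?thesis by simp
  qed (use pos[of a] in \<open>auto simp: set_integrable_def set_lebesgue_integral_def\<close>)
  then show "set_integrable lborel {0..} (?q a)" "(LINT t:{0..}|lborel. ?q a t) = pi / 2 * \<bar>a\<bar>"
    by auto
qed

text \<open>Product-to-sum formulas give four cosines, two with each sign. The inserted ones cancel,
  and they make each quotient integrable at 0 on its own.\<close>

lemma H_0_cos:
  "H 0 t * cos (x * t) = ((1 - cos ((2 + x) * t)) / t\<^sup>2 + (1 - cos ((2 - x) * t)) / t\<^sup>2
     - (1 - cos ((1 + x) * t)) / t\<^sup>2 - (1 - cos ((1 - x) * t)) / t\<^sup>2) / 4"
proof -
  have 1: "cos t * cos (x * t) = (cos ((1 + x) * t) + cos ((1 - x) * t)) / 2"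
    unfolding cos_times_cos by (simp add: algebra_simps)
  have 2: "cos (2 * t) * cos (x * t) = (cos ((2 + x) * t) + cos ((2 - x) * t)) / 2"
    unfolding cos_times_cos by (simp add: algebra_simps)
  have "H 0 t * cos (x * t) = (cos t * cos (x * t) - cos (2 * t) * cos (x * t)) / 2 / t\<^sup>2"
    by (simp add: algebra_simps diff_divide_distrib)
  also have "\<dots> = ((1 - cos ((2 + x) * t)) / t\<^sup>2 + (1 - cos ((2 - x) * t)) / t\<^sup>2
     - (1 - cos ((1 + x) * t)) / t\<^sup>2 - (1 - cos ((1 - x) * t)) / t\<^sup>2) / 4"
    unfolding 1 2 by (simp add: add_divide_distrib diff_divide_distrib)
  finally show ?thesis .
qed

text \<open>The combination of absolute values is a trapezoid in \<open>x\<close>: it equals 2 for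
  |x| at most 1, vanishes for |x| at least 2, and is linear in between.\<close>

lemma
  shows set_integrable_H_0_cos: "set_integrable lborel {0..} (\<lambda>t. H 0 t * cos (x * t))"
    and set_integral_H_0_cos: "(LINT t:{0..}|lborel. H 0 t * cos (x * t))
      = pi / 8 * (\<bar>2 + x\<bar> + \<bar>2 - x\<bar> - \<bar>1 + x\<bar> - \<bar>1 - x\<bar>)"
proof -
  note I = set_integrable_one_minus_cos
  show "set_integrable lborel {0..} (\<lambda>t. H 0 t * cos (x * t))"
    unfolding H_0_cos by (intro set_integrable_divide set_integral_diff(1) set_integral_add(1) I)
  show "(LINT t:{0..}|lborel. H 0 t * cos (x * t))
      = pi / 8 * (\<bar>2 + x\<bar> + \<bar>2 - x\<bar> - \<bar>1 + x\<bar> - \<bar>1 - x\<bar>)"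
    unfolding H_0_cos set_integral_divide_zero
      set_integral_diff(2)[OF set_integral_diff(1)[OF set_integral_add(1)[OF I I] I] I]
      set_integral_diff(2)[OF set_integral_add(1)[OF I I] I] set_integral_add(2)[OF I I]
      set_integral_one_minus_cos
    by (simp add: field_simps)
qed

text \<open>Integrability of one kernel makes the next continuous on \<open>{0..}\<close>, hence
  integrable on \<open>{0..1}\<close>; beyond 1 the decay of the tails takes over.\<close>

lemma set_integrable_H: "set_integrable lborel {0..} (H k)"
proof (induction k)
  case 0
  show ?case using set_integrable_H_0_cos[of 0] by (simp del: H.simps)
next
  case (Suc k)
  have "continuous_on {0..} (H (Suc k))"
    using continuous_on_tail_integral[OF Suc] by simp
  then have "set_integrable lborel {0..1} (H (Suc k))"
    by (intro borel_integrable_atLeastAtMost') (auto intro: continuous_on_subset)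
  then have "set_integrable lborel ({0..1} \<union> {1..}) (H (Suc k))"
    using set_integrable_H_1 by (intro set_integrable_Un) (auto simp del: H.simps)
  moreover have "{0..1} \<union> {1..} = {0::real..}" by auto
  ultimately show ?case by (simp del: H.simps)
qed

lemma continuous_on_H_Suc: "continuous_on {0..} (H (Suc k))"
  using continuous_on_tail_integral[OF set_integrable_H] by simp

lemma H_Suc_at_top: "(H (Suc k) \<longlongrightarrow> 0) at_top"
  using tail_integral_at_top[OF set_integrable_H] by simp

lemma isCont_H: "t > 0 \<Longrightarrow> isCont (H k) t"
proof (cases k)
  case (Suc j)
  assume "t > 0"
  then show ?thesis
    using continuous_on_interior[OF continuous_on_H_Suc, of t j] by (simp add: Suc del: H.simps)
next
  case 0
  assume "t > 0"
  then have "isCont (\<lambda>t. ((cos t - cos (2 * t)) / 2) / t\<^sup>2) t"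
    by (intro continuous_intros) auto
  then show ?thesis by (simp add: 0)
qed

lemma H_Suc_has_vector_derivative: "t > 0 \<Longrightarrow> (H (Suc k) has_vector_derivative - H k t) (at t)"
  using tail_integral_has_vector_derivative[OF set_integrable_H, of t k] isCont_H[of t k] by simp

text \<open>At frequency 0 the cosine transform shows that \<open>H 0\<close> itself has integral
  pi/4.\<close>

lemma C_0_ge_1: "1 \<le> C 0"
proof -
  have "pi / 4 = (LINT t:{0..}|lborel. H 0 t)"
    using set_integral_H_0_cos[of 0] by (simp del: H.simps)
  also have "\<dots> \<le> (LINT t:{0..}|lborel. \<bar>H 0 t\<bar>)"
    by (rule set_integral_mono[OF set_integrable_H set_integrable_abs[OF set_integrable_H] abs_ge_self])
  finally show ?thesis using pi_gt_zero by (simp add: C_def field_simps del: H.simps)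
qed

section \<open>Half-line Fourier transforms and integration by parts\<close>

definition FH :: "nat \<Rightarrow> real \<Rightarrow> complex" where
  "FH k x = (LINT t:{0..}|lborel. H k t *\<^sub>R cis (x * t))"

lemma set_integrable_H_cis: "set_integrable lborel {0..} (\<lambda>t. H k t *\<^sub>R cis (x * t))"
proof -
  have "integrable lborel (\<lambda>t. (indicator {0..} t *\<^sub>R H k t) *\<^sub>R cis (x * t))"
    using set_integrable_H[of k] unfolding set_integrable_def
    by (rule Bochner_Integration.integrable_bound)
       (use set_integrable_H[of k, unfolded set_integrable_def] in \<open>auto intro!: borel_measurable_scaleR\<close>)
  then show ?thesis unfolding set_integrable_def by simp
qed

lemma Re_FH_0: "Re (FH 0 x) = pi / 8 * (\<bar>2 + x\<bar> + \<bar>2 - x\<bar> - \<bar>1 + x\<bar> - \<bar>1 - x\<bar>)"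
  unfolding FH_def set_integral_Re(2)[OF set_integrable_H_cis, symmetric] set_integral_H_0_cos[symmetric]
  by simp

lemma FH_at_0: "FH k 0 = of_real (H (Suc k) 0)"
  by (simp add: FH_def set_integral_complex_of_real scaleR_conv_of_real del: H.simps(1))

text \<open>Integration by parts, with - \<open>H k\<close> the derivative of
  \<open>H (Suc k)\<close>. The boundary term at infinity vanishes and the one at 0 remains.\<close>

lemma FH_Suc: "FH k x = of_real (H (Suc k) 0) + \<i> * x * FH (Suc k) x"
proof -
  let ?F = "\<lambda>t. H (Suc k) t *\<^sub>R cis (x * t)"
  let ?f = "\<lambda>t. \<i> * x * (H (Suc k) t *\<^sub>R cis (x * t)) - H k t *\<^sub>R cis (x * t)"
  have lim: "(?F \<longlongrightarrow> 0) at_top"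
    by (rule Lim_null_comparison[OF _ tendsto_norm_zero[OF H_Suc_at_top[of k]]]) (simp del: H.simps)
  have "(LINT t:{0..}|lborel. ?f t) = 0 - ?F 0"
  proof (rule FTC_atLeast[OF _ _ _ _ lim])
    show "continuous_on {0..} ?F"
      by (intro continuous_on_scaleR continuous_on_H_Suc continuous_at_imp_continuous_on ballI isCont_cis)
    show "(?F has_vector_derivative ?f t) (at t)" if "0 < t" for t
      using has_vector_derivative_scaleR[OF _ cis_has_vector_derivative, of "H (Suc k)" "- H k t" t x]
        H_Suc_has_vector_derivative[OF that, of k]
      by (simp add: has_real_derivative_iff_has_vector_derivative algebra_simps del: H.simps)
    show "isCont ?f t" if "0 < t" for t
      using that by (intro continuous_intros isCont_H)
    show "set_integrable lborel {0..} ?f"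
      by (intro set_integral_diff(1) set_integrable_mult_right set_integrable_H_cis)
  qed
  moreover have "(LINT t:{0..}|lborel. ?f t) = \<i> * x * FH (Suc k) x - FH k x"
    unfolding FH_def set_integral_mult_right[symmetric]
    by (intro set_integral_diff(2) set_integrable_mult_right set_integrable_H_cis)
  ultimately show ?thesis
    by (simp add: scaleR_conv_of_real algebra_simps del: H.simps)
qed

text \<open>Dominated convergence with majorant |\<open>H k\<close>|. Only a sequence of frequencies
  in (0, 1] is needed to pass identities on that interval to the limit 0.\<close>

lemma FH_tendsto_0: "(\<lambda>j. FH k (1 / real (Suc j))) \<longlonglongrightarrow> FH k 0"
  unfolding FH_def set_lebesgue_integral_def
proof (rule integral_dominated_convergence)
  show "integrable lborel (\<lambda>t. norm (indicator {0..} t *\<^sub>R H k t))"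
    using set_integrable_H[of k] unfolding set_integrable_def by (rule integrable_norm)
  show "(\<lambda>t. indicator {0..} t *\<^sub>R H k t *\<^sub>R cis (x * t)) \<in> borel_measurable lborel" for x
    using set_integrable_H_cis[of k x] unfolding set_integrable_def by auto
  then show "(\<lambda>t. indicator {0..} t *\<^sub>R H k t *\<^sub>R cis (x * t)) \<in> borel_measurable lborel" for x .
  show "AE t in lborel. (\<lambda>j. indicator {0..} t *\<^sub>R H k t *\<^sub>R cis (1 / real (Suc j) * t))
      \<longlonglongrightarrow> indicator {0..} t *\<^sub>R H k t *\<^sub>R cis (0 * t)"
  proof (rule AE_I2)
    fix t :: real
    have "(\<lambda>j. 1 / real (Suc j)) \<longlonglongrightarrow> 0"
      by real_asymp
    from isCont_tendsto_compose[OF isCont_cis this, of t]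
    have "(\<lambda>j. cis (t * (1 / real (Suc j)))) \<longlonglongrightarrow> cis (t * 0)" .
    then show "(\<lambda>j. indicator {0..} t *\<^sub>R H k t *\<^sub>R cis (1 / real (Suc j) * t))
      \<longlonglongrightarrow> indicator {0..} t *\<^sub>R H k t *\<^sub>R cis (0 * t)"
      by (intro tendsto_scaleR tendsto_const) (simp add: mult.commute)
  qed
qed (auto simp: indicator_def)

text \<open>Each application of \<open>FH_Suc\<close> adds a boundary term whose real part must
  vanish. For even \<open>k\<close> the odd power of ix is purely imaginary. For odd
  \<open>k\<close> the power is real, and the kernel value itself is 0: on (0, 1] the left side is
  constantly pi/4, so by induction \<open>Re (FH (Suc k) y)\<close> vanishes there, and y tends to
  0.\<close>

lemma Re_FH_0_eq: "Re (FH 0 x) = pi / 4 + Re ((\<i> * x) ^ Suc k * FH (Suc k) x)"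
proof (induction k arbitrary: x)
  case 0
  have "H (Suc 0) 0 = pi / 4"
    using Re_FH_0[of 0] FH_at_0[of 0] by (simp del: H.simps)
  then show ?case using FH_Suc[of 0 x] by (simp del: H.simps)
next
  case (Suc k)
  have "Re ((\<i> * of_real x) ^ Suc k * complex_of_real (H (Suc (Suc k)) 0)) = 0"
  proof (cases "even k")
    case True
    then obtain m where "k = 2 * m" by blast
    then have "(\<i> * of_real x) ^ Suc k = \<i> * of_real (x * (- (x\<^sup>2)) ^ m)"
      by (simp add: power_mult power_mult_distrib)
    then show ?thesis by (simp only:) simp
  next
    case False
    then obtain m where m: "Suc k = 2 * m" by (metis even_Suc evenE)
    have pow: "(\<i> * complex_of_real y) ^ Suc k = of_real ((- (y\<^sup>2)) ^ m)" for y
      unfolding m by (simp add: power_mult power_mult_distrib)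
    have Re_0: "Re (FH (Suc k) y) = 0" if "0 < y" "y \<le> 1" for y
    proof -
      have "Re (FH 0 y) = pi / 4" using that unfolding Re_FH_0 by simp
      then have "Re ((\<i> * of_real y) ^ Suc k * FH (Suc k) y) = 0"
        using Suc.IH[of y] by linarith
      then show ?thesis using that unfolding pow by simp
    qed
    have "(\<lambda>j. 0) \<longlonglongrightarrow> Re (FH (Suc k) 0)"
      using tendsto_Re[OF FH_tendsto_0[of "Suc k"]] by (subst (asm) Re_0) auto
    then have "Re (FH (Suc k) 0) = 0"
      using LIMSEQ_unique tendsto_const by metis
    then have "H (Suc (Suc k)) 0 = 0"
      unfolding FH_at_0 by simp
    then show ?thesis by (simp del: H.simps)
  qed
  then have "Re ((\<i> * x) ^ Suc k * FH (Suc k) x) = Re ((\<i> * x) ^ Suc (Suc k) * FH (Suc (Suc k)) x)"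
    unfolding FH_Suc[of "Suc k" x] distrib_left by (simp add: mult_ac del: H.simps)
  then show ?case using Suc.IH by simp
qed

section \<open>The Bergman norm\<close>

lemma lborel_complex: "lborel = distr (lborel \<Otimes>\<^sub>M lborel) borel (\<lambda>(x, y). Complex x y)"
proof (rule lborel_eqI)
  have [measurable]: "(\<lambda>(x, y). Complex x y) \<in> borel_measurable (lborel \<Otimes>\<^sub>M lborel)"
    unfolding Complex_eq by measurable
  fix l u :: complex
  assume lu: "\<And>b. b \<in> Basis \<Longrightarrow> l \<bullet> b \<le> u \<bullet> b"
  then have le: "Re l \<le> Re u" "Im l \<le> Im u"
    using lu[of 1] lu[of \<i>] by (auto simp: Basis_complex_def inner_complex_def)
  have "(\<lambda>(x, y). Complex x y) -` box l u \<inter> space (lborel \<Otimes>\<^sub>M lborel)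
      = {Re l<..<Re u} \<times> {Im l<..<Im u}"
    by (auto simp: box_def Basis_complex_def inner_complex_def space_pair_measure)
  then have "emeasure (distr (lborel \<Otimes>\<^sub>M lborel) borel (\<lambda>(x, y). Complex x y)) (box l u)
      = ennreal (Re u - Re l) * ennreal (Im u - Im l)"
    using le by (simp add: emeasure_distr lborel.emeasure_pair_measure_Times)
  also have "\<dots> = ennreal (\<Prod>b\<in>Basis. (u - l) \<bullet> b)"
    using le by (simp add: Basis_complex_def inner_complex_def ennreal_mult)
  finally show "emeasure (distr (lborel \<Otimes>\<^sub>M lborel) borel (\<lambda>(x, y). Complex x y)) (box l u)
      = ennreal (\<Prod>b\<in>Basis. (u - l) \<bullet> b)" .
qed simp

lemma nn_integral_translate:
  assumes [measurable]: "(f :: real \<Rightarrow> ennreal) \<in> borel_measurable borel"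
  shows "(\<integral>\<^sup>+x. f (x + c) \<partial>lborel) = (\<integral>\<^sup>+x. f x \<partial>lborel)"
  using nn_integral_real_affine[OF assms, of 1 c] by (simp add: add.commute)

text \<open>With the second coordinate fixed, a shear is a translation of the first, so Fubini
  reduces the claim to the line.\<close>

lemma nn_integral_shear_fst:
  assumes [measurable]: "(f :: real \<times> real \<Rightarrow> ennreal) \<in> borel_measurable (lborel \<Otimes>\<^sub>M lborel)"
  shows "(\<integral>\<^sup>+z. f (fst z + a * snd z, snd z) \<partial>(lborel \<Otimes>\<^sub>M lborel)) = (\<integral>\<^sup>+z. f z \<partial>(lborel \<Otimes>\<^sub>M lborel))"
proof -
  have "(\<integral>\<^sup>+z. f (fst z + a * snd z, snd z) \<partial>(lborel \<Otimes>\<^sub>M lborel))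
      = (\<integral>\<^sup>+y. \<integral>\<^sup>+x. f (x + a * y, y) \<partial>lborel \<partial>lborel)"
    by (subst lborel_pair.nn_integral_snd[symmetric]) auto
  also have "\<dots> = (\<integral>\<^sup>+y. \<integral>\<^sup>+x. f (x, y) \<partial>lborel \<partial>lborel)"
    by (intro nn_integral_cong nn_integral_translate[where f = "\<lambda>x. f (x, y)" for y]) measurable
  also have "\<dots> = (\<integral>\<^sup>+z. f z \<partial>(lborel \<Otimes>\<^sub>M lborel))"
    by (subst lborel_pair.nn_integral_snd) auto
  finally show ?thesis .
qed

lemma nn_integral_shear_snd:
  assumes [measurable]: "(f :: real \<times> real \<Rightarrow> ennreal) \<in> borel_measurable (lborel \<Otimes>\<^sub>M lborel)"
  shows "(\<integral>\<^sup>+z. f (fst z, snd z + a * fst z) \<partial>(lborel \<Otimes>\<^sub>M lborel)) = (\<integral>\<^sup>+z. f z \<partial>(lborel \<Otimes>\<^sub>M lborel))"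
proof -
  have "(\<integral>\<^sup>+z. f (fst z, snd z + a * fst z) \<partial>(lborel \<Otimes>\<^sub>M lborel))
      = (\<integral>\<^sup>+x. \<integral>\<^sup>+y. f (x, y + a * x) \<partial>lborel \<partial>lborel)"
    by (subst lborel.nn_integral_fst[symmetric]) auto
  also have "\<dots> = (\<integral>\<^sup>+x. \<integral>\<^sup>+y. f (x, y) \<partial>lborel \<partial>lborel)"
    by (intro nn_integral_cong nn_integral_translate[where f = "\<lambda>y. f (x, y)" for x]) measurable
  also have "\<dots> = (\<integral>\<^sup>+z. f z \<partial>(lborel \<Otimes>\<^sub>M lborel))"
    by (subst lborel.nn_integral_fst) auto
  finally show ?thesis .
qed

lemma nn_integral_lborel_complex:
  assumes [measurable]: "(f :: complex \<Rightarrow> ennreal) \<in> borel_measurable borel"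
  shows "(\<integral>\<^sup>+z. f z \<partial>lborel) = (\<integral>\<^sup>+z. f (Complex (fst z) (snd z)) \<partial>(lborel \<Otimes>\<^sub>M lborel))"
proof -
  have [measurable]: "(\<lambda>(x, y). Complex x y) \<in> borel_measurable (lborel \<Otimes>\<^sub>M lborel)"
    unfolding Complex_eq by measurable
  show ?thesis
    by (subst lborel_complex) (simp add: nn_integral_distr case_prod_beta)
qed

text \<open>
  A rotation by \<open>s\<close> is a product of three shears: with \<open>\<tau> = tan (s/2)\<close>, apply \<open>(x, y) \<mapsto> (x - \<tau> y, y)\<close>,
  then \<open>(x, y) \<mapsto> (x, y + sin s \<cdot> x)\<close>, then the first shear again.
\<close>

lemma nn_integral_rotate_aux:
  assumes f [measurable]: "(f :: complex \<Rightarrow> ennreal) \<in> borel_measurable borel" and s: "cos (s / 2) \<noteq> 0"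
  shows "(\<integral>\<^sup>+z. f (cis s * z) \<partial>lborel) = (\<integral>\<^sup>+z. f z \<partial>lborel)"
proof -
  define \<tau> where "\<tau> = tan (s / 2)"
  have sin: "sin s = 2 * sin (s / 2) * cos (s / 2)" and cos: "cos s = 2 * (cos (s / 2))\<^sup>2 - 1"
    using sin_double[of "s / 2"] cos_double_cos[of "s / 2"] by auto
  \<comment> \<open>These two half-angle identities turn the product of the shear matrices into the
    rotation matrix.\<close>
  have 1: "\<tau> * (1 + cos s) = sin s"
    using s by (simp add: \<tau>_def tan_def sin cos power2_eq_square)
  have "\<tau> * sin s = 2 * (sin (s / 2))\<^sup>2"
    using s by (simp add: \<tau>_def tan_def sin power2_eq_square)
  then have 2: "1 - \<tau> * sin s = cos s"
    using cos_double_sin[of "s / 2"] by simp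
  have [measurable]: "(\<lambda>z. Complex (g z) (h z)) \<in> borel_measurable M"
    if "g \<in> borel_measurable M" "h \<in> borel_measurable M" for g h and M :: "(real \<times> real) measure"
    using that unfolding Complex_eq by measurable
  define F where "F = (\<lambda>z. f (Complex (fst z) (snd z)))"
  have F [measurable]: "F \<in> borel_measurable (lborel \<Otimes>\<^sub>M lborel)"
    unfolding F_def by measurable
  define F1 where "F1 = (\<lambda>z. F (fst z + - \<tau> * snd z, snd z))"
  have F1 [measurable]: "F1 \<in> borel_measurable (lborel \<Otimes>\<^sub>M lborel)"
    unfolding F1_def by measurable
  define F2 where "F2 = (\<lambda>z. F1 (fst z, snd z + sin s * fst z))"
  have F2 [measurable]: "F2 \<in> borel_measurable (lborel \<Otimes>\<^sub>M lborel)"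
    unfolding F2_def by measurable
  have "f (cis s * Complex x y) = F2 (x + - \<tau> * y, y)" for x y
  proof -
    have y: "y + sin s * (x + - \<tau> * y) = sin s * x + cos s * y"
      unfolding 2[symmetric] by (simp add: algebra_simps)
    have "x - \<tau> * y - \<tau> * (sin s * x + cos s * y) = (1 - \<tau> * sin s) * x - \<tau> * (1 + cos s) * y"
      by (simp add: algebra_simps)
    then have x: "x - \<tau> * y - \<tau> * (sin s * x + cos s * y) = cos s * x - sin s * y"
      unfolding 1 2 .
    have "cis s * Complex x y = Complex (cos s * x - sin s * y) (sin s * x + cos s * y)"
      by (simp add: complex_eq_iff)
    then show ?thesis
      unfolding F2_def F1_def F_def fst_conv snd_conv y using x by simp
  qed
  then have "(\<integral>\<^sup>+z. f (cis s * z) \<partial>lborel)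
      = (\<integral>\<^sup>+z. F2 (fst z + - \<tau> * snd z, snd z) \<partial>(lborel \<Otimes>\<^sub>M lborel))"
    by (subst nn_integral_lborel_complex) auto
  also have "\<dots> = (\<integral>\<^sup>+z. F2 z \<partial>(lborel \<Otimes>\<^sub>M lborel))"
    by (rule nn_integral_shear_fst[OF F2])
  also have "\<dots> = (\<integral>\<^sup>+z. F1 z \<partial>(lborel \<Otimes>\<^sub>M lborel))"
    unfolding F2_def by (rule nn_integral_shear_snd[OF F1])
  also have "\<dots> = (\<integral>\<^sup>+z. F z \<partial>(lborel \<Otimes>\<^sub>M lborel))"
    unfolding F1_def by (rule nn_integral_shear_fst[OF F])
  also have "\<dots> = (\<integral>\<^sup>+z. f z \<partial>lborel)"
    unfolding F_def by (rule nn_integral_lborel_complex[OF f, symmetric])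
  finally show ?thesis .
qed

lemma nn_integral_rotate:
  assumes f [measurable]: "(f :: complex \<Rightarrow> ennreal) \<in> borel_measurable borel"
  shows "(\<integral>\<^sup>+z. f (cis s * z) \<partial>lborel) = (\<integral>\<^sup>+z. f z \<partial>lborel)"
proof (cases "cos (s / 2) = 0")
  case True
  \<comment> \<open>The tangent of s/2 is undefined here, so the rotation is done as two rotations
    by s/2. If cos(s/4) were 0 as well, cos(s/2) would be -1.\<close>
  then have "cos (s / 2 / 2) \<noteq> 0"
    using cos_double_cos[of "s / 2 / 2"] by auto
  note half = nn_integral_rotate_aux[OF _ this]
  have "(\<integral>\<^sup>+z. f (cis (s/2) * (cis (s / 2) * z)) \<partial>lborel) = (\<integral>\<^sup>+z. f (cis (s/2) * z) \<partial>lborel)"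
    by (rule half) measurable
  also have "\<dots> = (\<integral>\<^sup>+z. f z \<partial>lborel)"
    by (rule half) measurable
  finally show ?thesis by (simp add: mult.assoc[symmetric] cis_mult)
qed (rule nn_integral_rotate_aux[OF f])

section \<open>The weighted measure on the disc\<close>

lemma space_bergman_measure [simp]: "space (bergman_measure \<alpha>) = ball 0 1"
  by (simp add: bergman_measure_def space_restrict_space)

lemma sets_bergman_measure [measurable_cong]: "sets (bergman_measure \<alpha>) = sets (restrict_space borel (ball 0 1))"
  by (simp add: bergman_measure_def sets_restrict_space)

lemma measurable_bergman_continuous:
  "continuous_on (ball 0 1) f \<Longrightarrow> f \<in> borel_measurable (bergman_measure \<alpha>)"
  using borel_measurable_continuous_on_restrict measurable_cong_sets[OF sets_bergman_measure refl] by blast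

text \<open>A finite-valued density preserves sigma-finiteness; Fubini in
  \<open>bergman_le_integral\<close> relies on this.\<close>

lemma sigma_finite_bergman: "sigma_finite_measure (bergman_measure \<alpha>)"
proof -
  interpret R: sigma_finite_measure "restrict_space lborel (ball 0 1 :: complex set)"
    by (rule sigma_finite_measure_restrict_space[OF lborel.sigma_finite_measure_axioms]) auto
  have "(\<lambda>z. ennreal ((\<alpha> + 1) / pi * (1 - (cmod z)\<^sup>2) powr \<alpha>)) \<in> borel_measurable (restrict_space lborel (ball 0 1))"
    by (intro measurable_restrict_space1) measurable
  from R.sigma_finite_iff_density_finite[OF this] show ?thesis
    unfolding bergman_measure_def by simp
qed

text \<open>Extension by zero to the whole plane, where \<open>nn_integral_rotate\<close>
  applies.\<close>

lemma nn_integral_bergman: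
  assumes g: "g \<in> borel_measurable (bergman_measure \<alpha>)"
  shows "(\<integral>\<^sup>+z. g z \<partial>bergman_measure \<alpha>)
    = (\<integral>\<^sup>+z. ennreal ((\<alpha> + 1) / pi * (1 - (cmod z)\<^sup>2) powr \<alpha>) * (g z * indicator (ball 0 1) z) \<partial>lborel)"
proof -
  have g': "g \<in> borel_measurable (restrict_space lborel (ball 0 1))"
    using g measurable_cong_sets[OF _ refl, of "bergman_measure \<alpha>" "restrict_space lborel (ball 0 1)"]
    by (simp add: bergman_measure_def)
  have w: "(\<lambda>z. ennreal ((\<alpha> + 1) / pi * (1 - (cmod z)\<^sup>2) powr \<alpha>)) \<in> borel_measurable (restrict_space lborel (ball 0 1))"
    by (intro measurable_restrict_space1) measurable
  show ?thesis
    unfolding bergman_measure_def nn_integral_density[OF w g']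
    by (subst nn_integral_restrict_space) (auto simp: mult.assoc)
qed

lemma measurable_bergman_rotate:
  "(\<lambda>z. cis t * z) \<in> measurable (bergman_measure \<alpha>) (bergman_measure \<alpha>)"
proof -
  have "(\<lambda>z. cis t * z) \<in> measurable (restrict_space borel (ball 0 1)) (restrict_space borel (ball 0 1))"
    by (intro measurable_restrict_space2 measurable_restrict_space1) (auto simp: space_restrict_space norm_mult)
  then show ?thesis
    using measurable_cong_sets[OF sets_bergman_measure sets_bergman_measure] by blast
qed

text \<open>Weight and disc depend on the modulus only, so the invariance of Lebesgue measure is
  inherited.\<close>

lemma nn_integral_bergman_rotate:
  assumes g [measurable]: "g \<in> borel_measurable (bergman_measure \<alpha>)"
  shows "(\<integral>\<^sup>+z. g (cis t * z) \<partial>bergman_measure \<alpha>) = (\<integral>\<^sup>+z. g z \<partial>bergman_measure \<alpha>)"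
proof -
  let ?h = "\<lambda>z. ennreal ((\<alpha> + 1) / pi * (1 - (cmod z)\<^sup>2) powr \<alpha>) * (g z * indicator (ball 0 1) z)"
  have "g \<in> borel_measurable (restrict_space lborel (ball 0 1))"
    using g measurable_cong_sets[OF _ refl, of "bergman_measure \<alpha>" "restrict_space lborel (ball 0 1)"]
    by (simp add: bergman_measure_def)
  then have [measurable]: "(\<lambda>z. g z * indicator (ball 0 1) z) \<in> borel_measurable borel"
    by (subst (asm) borel_measurable_restrict_space_iff_ennreal) auto
  have g': "(\<lambda>z. g (cis t * z)) \<in> borel_measurable (bergman_measure \<alpha>)"
    using measurable_compose[OF measurable_bergman_rotate g] .
  have "(\<integral>\<^sup>+z. g (cis t * z) \<partial>bergman_measure \<alpha>) = (\<integral>\<^sup>+z. ?h (cis t * z) \<partial>lborel)"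
    unfolding nn_integral_bergman[OF g'] by (simp add: norm_mult indicator_def)
  also have "\<dots> = (\<integral>\<^sup>+z. ?h z \<partial>lborel)"
    by (rule nn_integral_rotate) measurable
  finally show ?thesis unfolding nn_integral_bergman[OF g] .
qed

text \<open>A bound on \<open>bergman_norm\<close> alone would hold vacuously for nonintegrable
  functions, whose Bochner integral is 0 by default. The nonnegative integral forces
  finiteness.\<close>

definition bergman_le :: "real \<Rightarrow> real \<Rightarrow> real \<Rightarrow> (complex \<Rightarrow> complex) \<Rightarrow> bool" where
  "bergman_le p \<alpha> M g \<longleftrightarrow> 0 \<le> M \<and> g \<in> borel_measurable (bergman_measure \<alpha>) \<and>
     (\<integral>\<^sup>+z. ennreal (cmod (g z) powr p) \<partial>bergman_measure \<alpha>) \<le> ennreal (M powr p)"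

lemma bergman_le_integrable:
  assumes "bergman_le p \<alpha> M g"
  shows "integrable (bergman_measure \<alpha>) (\<lambda>z. cmod (g z) powr p)"
proof (rule integrableI_nonneg)
  show "(\<integral>\<^sup>+z. ennreal (cmod (g z) powr p) \<partial>bergman_measure \<alpha>) < \<infinity>"
    using assms unfolding bergman_le_def by (auto simp: le_less_trans)
  have [measurable]: "g \<in> borel_measurable (bergman_measure \<alpha>)"
    using assms unfolding bergman_le_def by auto
  show "(\<lambda>z. cmod (g z) powr p) \<in> borel_measurable (bergman_measure \<alpha>)" by measurable
qed auto

lemma bergman_norm_leI:
  assumes "bergman_le p \<alpha> M g" "p > 0"
  shows "bergman_norm p \<alpha> g \<le> M"
proof -
  have "ennreal (\<integral>z. cmod (g z) powr p \<partial>bergman_measure \<alpha>) \<le> ennreal (M powr p)"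
    using nn_integral_eq_integral[OF bergman_le_integrable[OF assms(1)]] assms(1)
    unfolding bergman_le_def by simp
  then have "(\<integral>z. cmod (g z) powr p \<partial>bergman_measure \<alpha>) \<le> M powr p"
    by simp
  then have "bergman_norm p \<alpha> g \<le> (M powr p) powr (1 / p)"
    unfolding bergman_norm_def using assms by (intro powr_mono2) auto
  then show ?thesis
    using assms by (simp add: powr_powr bergman_le_def)
qed

lemma bergman_leI:
  assumes "g \<in> borel_measurable (bergman_measure \<alpha>)"
    and int: "integrable (bergman_measure \<alpha>) (\<lambda>z. cmod (g z) powr p)"
    and le: "bergman_norm p \<alpha> g \<le> M" and "p > 0"
  shows "bergman_le p \<alpha> M g"
proof -
  have "0 \<le> bergman_norm p \<alpha> g" unfolding bergman_norm_def by simp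
  have "(\<integral>\<^sup>+z. ennreal (cmod (g z) powr p) \<partial>bergman_measure \<alpha>)
      = ennreal (bergman_norm p \<alpha> g powr p)"
    using nn_integral_eq_integral[OF int] assms(4) by (simp add: bergman_norm_def powr_powr)
  also have "\<dots> \<le> ennreal (M powr p)"
    using assms \<open>0 \<le> bergman_norm p \<alpha> g\<close> by (intro ennreal_leI powr_mono2) auto
  finally show ?thesis
    unfolding bergman_le_def using assms \<open>0 \<le> bergman_norm p \<alpha> g\<close> by auto
qed

lemma bergman_le_mono: "bergman_le p \<alpha> M g \<Longrightarrow> M \<le> M' \<Longrightarrow> p > 0 \<Longrightarrow> bergman_le p \<alpha> M' g"
  unfolding bergman_le_def using order_trans[OF _ ennreal_leI[OF powr_mono2[of p M M']]] by auto

lemma bergman_le_cong: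
  assumes "bergman_le p \<alpha> M g" "\<And>z. cmod z < 1 \<Longrightarrow> g z = g' z"
  shows "bergman_le p \<alpha> M g'"
proof -
  have "g' \<in> borel_measurable (bergman_measure \<alpha>) \<longleftrightarrow> g \<in> borel_measurable (bergman_measure \<alpha>)"
    by (rule measurable_cong) (use assms in auto)
  moreover have "(\<integral>\<^sup>+z. ennreal (cmod (g' z) powr p) \<partial>bergman_measure \<alpha>)
      = (\<integral>\<^sup>+z. ennreal (cmod (g z) powr p) \<partial>bergman_measure \<alpha>)"
    by (rule nn_integral_cong) (use assms in auto)
  ultimately show ?thesis using assms(1) unfolding bergman_le_def by simp
qed

lemma bergman_le_rotate:
  assumes "bergman_le p \<alpha> M g"
  shows "bergman_le p \<alpha> M (\<lambda>z. g (cis t * z))"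
proof -
  have [measurable]: "g \<in> borel_measurable (bergman_measure \<alpha>)"
    using assms unfolding bergman_le_def by auto
  have "(\<lambda>z. g (cis t * z)) \<in> borel_measurable (bergman_measure \<alpha>)"
    by (rule measurable_compose[OF measurable_bergman_rotate]) measurable
  moreover have "(\<integral>\<^sup>+z. ennreal (cmod (g (cis t * z)) powr p) \<partial>bergman_measure \<alpha>)
      = (\<integral>\<^sup>+z. ennreal (cmod (g z) powr p) \<partial>bergman_measure \<alpha>)"
    by (rule nn_integral_bergman_rotate) measurable
  ultimately show ?thesis
    using assms unfolding bergman_le_def by auto
qed

text \<open>The graph of x^p lies above its tangent at \<open>l\<close>. For x > 0 this is Young's
  inequality for x^p and l^p with weights 1/p and 1 - 1/p.\<close>

lemma powr_tangent:
  fixes x l p :: real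
  assumes "1 < p" "0 \<le> x" "0 < l"
  shows "l powr p + p * l powr (p - 1) * (x - l) \<le> x powr p"
proof (cases "x = 0")
  case True
  have "l powr (p - 1) * l = l powr p" using assms by (simp add: powr_diff)
  moreover have "(1 - p) * l powr p \<le> 0" using assms by (simp add: mult_nonpos_nonneg)
  ultimately show ?thesis using True assms by (simp add: algebra_simps)
next
  case False
  then have "(x powr p) powr (1 / p) * (l powr p) powr (1 - 1 / p) \<le> 1 / p * x powr p + (1 - 1 / p) * l powr p"
    using assms by (intro Youngs_inequality_0) auto
  moreover have "(x powr p) powr (1 / p) = x" "(l powr p) powr (1 - 1 / p) = l powr (p - 1)"
    using assms False by (simp_all add: powr_powr right_diff_distrib)
  ultimately have "p * (x * l powr (p - 1)) \<le> p * (1 / p * x powr p + (1 - 1 / p) * l powr p)"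
    using assms by (intro mult_left_mono) auto
  also have "\<dots> = x powr p + (p - 1) * l powr p"
    using assms by (simp add: field_simps)
  finally have "p * (x * l powr (p - 1)) \<le> x powr p + (p - 1) * l powr p" .
  moreover have "l powr (p - 1) * l = l powr p" using assms by (simp add: powr_diff)
  ultimately show ?thesis by (simp add: algebra_simps)
qed

text \<open>
  Jensen's inequality for the probability density \<open>\<bar>k\<bar> / \<integral>\<bar>k\<bar>\<close>, by integrating the tangent of \<open>x\<^sup>p\<close> at the mean.
\<close>

lemma norm_integral_powr_le:
  fixes k F :: "'a \<Rightarrow> complex"
  assumes p: "1 < p" and k: "integrable N k" and F [measurable]: "F \<in> borel_measurable N"
  shows "ennreal (cmod (\<integral>t. k t * F t \<partial>N) powr p)
    \<le> ennreal ((\<integral>t. cmod (k t) \<partial>N) powr (p - 1)) * (\<integral>\<^sup>+t. ennreal (cmod (k t) * cmod (F t) powr p) \<partial>N)"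
    (is "_ \<le> ennreal (?c powr _) * ?J")
proof (cases "integrable N (\<lambda>t. k t * F t) \<and> (\<integral>t. k t * F t \<partial>N) \<noteq> 0")
  case False
  \<comment> \<open>A nonintegrable product has Bochner integral 0 by default, so both alternatives
    make the left side 0.\<close>
  then have "(\<integral>t. k t * F t \<partial>N) = 0"
    by (auto simp: not_integrable_integral_eq)
  then show ?thesis by simp
next
  case True
  have [measurable]: "k \<in> borel_measurable N" using k by auto
  define I where "I = (\<integral>t. cmod (k t) * cmod (F t) \<partial>N)"
  have int: "integrable N (\<lambda>t. cmod (k t) * cmod (F t))"
    using integrable_norm[of N "\<lambda>t. k t * F t"] True by (simp add: norm_mult)
  have le: "cmod (\<integral>t. k t * F t \<partial>N) \<le> I"
    unfolding I_def using integral_norm_bound[of N "\<lambda>t. k t * F t"] by (simp add: norm_mult)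
  with True have I: "I > 0" by (metis norm_le_zero_iff linorder_not_le order_trans)
  have c: "?c > 0"
  proof (rule ccontr)
    assume "\<not> ?c > 0"
    then have "?c = 0" by (simp add: antisym)
    then have "AE t in N. cmod (k t) = 0"
      using integral_nonneg_eq_0_iff_AE[OF integrable_norm[OF k]] by simp
    then have "I = 0" unfolding I_def by (intro integral_eq_zero_AE) auto
    with I show False by simp
  qed
  show ?thesis
  proof (cases "?J = \<infinity>")
    case True
    then show ?thesis using c by (simp add: ennreal_mult_top)
  next
    case False
    have intp: "integrable N (\<lambda>t. cmod (k t) * cmod (F t) powr p)"
      by (rule integrableI_nonneg) (use False in \<open>auto simp: top.not_eq_extremum\<close>)
    define l where "l = I / ?c"
    have l: "l > 0" using I c by (simp add: l_def)
    \<comment> \<open>This is |k| times the tangent at \<open>l\<close>. Its linear term integrates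
      to 0 because I = ?c l, which leaves ?c l^p.\<close>
    let ?T = "\<lambda>t. (l powr p - p * l powr (p - 1) * l) * cmod (k t) + p * l powr (p - 1) * (cmod (k t) * cmod (F t))"
    have "(\<integral>t. ?T t \<partial>N) = (l powr p - p * l powr (p - 1) * l) * ?c + p * l powr (p - 1) * I"
      using int integrable_norm[OF k] by (simp add: I_def)
    also have "\<dots> = ?c * l powr p"
      using c by (simp add: l_def algebra_simps)
    finally have T: "(\<integral>t. ?T t \<partial>N) = ?c * l powr p" .
    have "(\<integral>t. ?T t \<partial>N) \<le> (\<integral>t. cmod (k t) * cmod (F t) powr p \<partial>N)"
    proof (rule integral_mono[OF _ intp])
      show "integrable N ?T" using int integrable_norm[OF k] by simp
      fix t
      show "?T t \<le> cmod (k t) * cmod (F t) powr p"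
        using mult_left_mono[OF powr_tangent[OF p norm_ge_zero[of "F t"] l] norm_ge_zero[of "k t"]]
        by (simp add: algebra_simps)
    qed
    then have J: "?c * l powr p \<le> (\<integral>t. cmod (k t) * cmod (F t) powr p \<partial>N)"
      unfolding T .
    have "cmod (\<integral>t. k t * F t \<partial>N) powr p \<le> I powr p"
      using le p by (intro powr_mono2) auto
    also have "I powr p = ?c powr p * l powr p"
      using c l by (simp add: l_def powr_mult[symmetric])
    also have "\<dots> = ?c powr (p - 1) * (?c * l powr p)"
      using c by (simp add: powr_diff)
    also have "\<dots> \<le> ?c powr (p - 1) * (\<integral>t. cmod (k t) * cmod (F t) powr p \<partial>N)"
      using J by (intro mult_left_mono) auto
    finally have "ennreal (cmod (\<integral>t. k t * F t \<partial>N) powr p) \<le>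
        ennreal (?c powr (p - 1)) * ennreal (\<integral>t. cmod (k t) * cmod (F t) powr p \<partial>N)"
      by (subst ennreal_mult[symmetric]) (auto intro!: ennreal_leI)
    also have "ennreal (\<integral>t. cmod (k t) * cmod (F t) powr p \<partial>N) = ?J"
      by (rule nn_integral_eq_integral[OF intp, symmetric]) auto
    finally show ?thesis .
  qed
qed

text \<open>Minkowski's integral inequality: \<open>norm_integral_powr_le\<close> at each
  \<open>z\<close>, then an exchange of the two integrals.\<close>

lemma bergman_le_integral:
  fixes k :: "'a \<Rightarrow> complex" and F :: "'a \<Rightarrow> complex \<Rightarrow> complex"
  assumes p: "1 < p" and N: "sigma_finite_measure N" and k: "integrable N k"
    and F [measurable]: "case_prod F \<in> borel_measurable (N \<Otimes>\<^sub>M bergman_measure \<alpha>)"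
    and le: "\<And>t. t \<in> space N \<Longrightarrow> bergman_le p \<alpha> M (F t)" and M: "0 \<le> M"
    and c: "(\<integral>t. cmod (k t) \<partial>N) \<le> c"
  shows "bergman_le p \<alpha> (c * M) (\<lambda>z. \<integral>t. k t * F t z \<partial>N)"
proof -
  interpret N: sigma_finite_measure N by fact
  interpret B: sigma_finite_measure "bergman_measure \<alpha>" by (rule sigma_finite_bergman)
  interpret P: pair_sigma_finite N "bergman_measure \<alpha>" ..
  have [measurable]: "k \<in> borel_measurable N" using k by auto
  let ?c = "\<integral>t. cmod (k t) \<partial>N"
  have c0: "0 \<le> ?c" by simp
  have [measurable]: "(\<lambda>(z, t). F t z) \<in> borel_measurable (bergman_measure \<alpha> \<Otimes>\<^sub>M N)"
    using measurable_compose[OF measurable_pair_swap' F] by (simp add: case_prod_beta)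
  have m: "(\<lambda>z. \<integral>t. k t * F t z \<partial>N) \<in> borel_measurable (bergman_measure \<alpha>)"
    by measurable
  have "(\<integral>\<^sup>+z. ennreal (cmod (\<integral>t. k t * F t z \<partial>N) powr p) \<partial>bergman_measure \<alpha>)
      \<le> (\<integral>\<^sup>+z. ennreal (?c powr (p - 1)) * (\<integral>\<^sup>+t. ennreal (cmod (k t) * cmod (F t z) powr p) \<partial>N) \<partial>bergman_measure \<alpha>)"
  proof (rule nn_integral_mono)
    fix z assume [measurable]: "z \<in> space (bergman_measure \<alpha>)"
    show "ennreal (cmod (\<integral>t. k t * F t z \<partial>N) powr p)
      \<le> ennreal (?c powr (p - 1)) * (\<integral>\<^sup>+t. ennreal (cmod (k t) * cmod (F t z) powr p) \<partial>N)"
      by (rule norm_integral_powr_le[OF p k]) measurable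
  qed
  also have "\<dots> = ennreal (?c powr (p - 1)) *
      (\<integral>\<^sup>+z. (\<integral>\<^sup>+t. ennreal (cmod (k t) * cmod (F t z) powr p) \<partial>N) \<partial>bergman_measure \<alpha>)"
    by (rule nn_integral_cmult) measurable
  also have "(\<integral>\<^sup>+z. (\<integral>\<^sup>+t. ennreal (cmod (k t) * cmod (F t z) powr p) \<partial>N) \<partial>bergman_measure \<alpha>)
      = (\<integral>\<^sup>+t. (\<integral>\<^sup>+z. ennreal (cmod (k t) * cmod (F t z) powr p) \<partial>bergman_measure \<alpha>) \<partial>N)"
    by (rule P.Fubini') measurable
  also have "\<dots> \<le> (\<integral>\<^sup>+t. ennreal (cmod (k t)) * ennreal (M powr p) \<partial>N)"
  proof (rule nn_integral_mono)
    fix t assume t [measurable]: "t \<in> space N"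
    have "(\<integral>\<^sup>+z. ennreal (cmod (k t) * cmod (F t z) powr p) \<partial>bergman_measure \<alpha>)
        = ennreal (cmod (k t)) * (\<integral>\<^sup>+z. ennreal (cmod (F t z) powr p) \<partial>bergman_measure \<alpha>)"
      by (subst nn_integral_cmult[symmetric]) (auto simp: ennreal_mult)
    also have "\<dots> \<le> ennreal (cmod (k t)) * ennreal (M powr p)"
      using le[OF t] unfolding bergman_le_def by (intro mult_left_mono) auto
    finally show "(\<integral>\<^sup>+z. ennreal (cmod (k t) * cmod (F t z) powr p) \<partial>bergman_measure \<alpha>)
        \<le> ennreal (cmod (k t)) * ennreal (M powr p)" .
  qed
  also have "\<dots> = ennreal ?c * ennreal (M powr p)"
    by (subst nn_integral_multc) (auto simp: nn_integral_eq_integral[OF integrable_norm[OF k]])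
  also have "ennreal (?c powr (p - 1)) * (ennreal ?c * ennreal (M powr p)) = ennreal ((?c * M) powr p)"
  proof -
    have "?c powr (p - 1) * (?c * M powr p) = (?c * M) powr p"
      using c0 M p by (cases "?c = 0") (auto simp: powr_mult powr_diff)
    then show ?thesis using c0 by (simp add: ennreal_mult[symmetric])
  qed
  finally have "(\<integral>\<^sup>+z. ennreal (cmod (\<integral>t. k t * F t z \<partial>N) powr p) \<partial>bergman_measure \<alpha>)
      \<le> ennreal ((?c * M) powr p)"
    by (simp add: mult_left_mono)
  then have "bergman_le p \<alpha> (?c * M) (\<lambda>z. \<integral>t. k t * F t z \<partial>N)"
    unfolding bergman_le_def using m c0 M by simp
  then show ?thesis
    by (rule bergman_le_mono) (use c M p in \<open>auto intro: mult_right_mono\<close>)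
qed

text \<open>Convexity of x^p at the points x/A and y/A' with weights proportional to A and A'; both
  tangents are taken at the weighted mean, so their linear terms cancel.\<close>

lemma powr_add_convex:
  fixes x y A A' p :: real
  assumes "1 < p" "0 \<le> x" "0 \<le> y" "0 < A" "0 < A'"
  shows "(x + y) powr p \<le> (A + A') powr (p - 1) * (A * (x / A) powr p + A' * (y / A') powr p)"
proof (cases "x + y = 0")
  case False
  define l where "l = (x + y) / (A + A')"
  have l: "l > 0" using assms False by (auto simp: l_def intro!: divide_pos_pos)
  have e: "(A + A') * l = x + y" using assms by (simp add: l_def)
  have "A * (l powr p + p * l powr (p - 1) * (x / A - l)) + A' * (l powr p + p * l powr (p - 1) * (y / A' - l))
      \<le> A * (x / A) powr p + A' * (y / A') powr p"
    using assms l by (intro add_mono mult_left_mono powr_tangent) auto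
  also have "A * (l powr p + p * l powr (p - 1) * (x / A - l)) + A' * (l powr p + p * l powr (p - 1) * (y / A' - l))
      = (A + A') * l powr p + p * l powr (p - 1) * (x + y - (A + A') * l)"
    using assms by (simp add: field_simps)
  also have "\<dots> = (A + A') * l powr p" unfolding e by simp
  finally have "(A + A') powr (p - 1) * ((A + A') * l powr p)
      \<le> (A + A') powr (p - 1) * (A * (x / A) powr p + A' * (y / A') powr p)"
    by (intro mult_left_mono) auto
  moreover have "(A + A') powr (p - 1) * ((A + A') * l powr p) = (x + y) powr p"
    using assms l unfolding e[symmetric] by (simp add: powr_mult powr_diff)
  ultimately show ?thesis by simp
qed (use assms in auto)

text \<open>Minkowski for sums. After integrating \<open>powr_add_convex\<close>, the two normalised
  terms contribute at most A and A', which gives (A + A')^(p-1) (A + A').\<close>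

lemma bergman_le_add_pos:
  assumes p: "1 < p" and g: "bergman_le p \<alpha> A g" and h: "bergman_le p \<alpha> A' h" and A: "0 < A" and A': "0 < A'"
  shows "bergman_le p \<alpha> (A + A') (\<lambda>z. g z + h z)"
proof -
  have [measurable]: "g \<in> borel_measurable (bergman_measure \<alpha>)" "h \<in> borel_measurable (bergman_measure \<alpha>)"
    using g h unfolding bergman_le_def by auto
  have pt: "cmod (g z + h z) powr p \<le>
      (A + A') powr (p - 1) * A / A powr p * cmod (g z) powr p + (A + A') powr (p - 1) * A' / A' powr p * cmod (h z) powr p" for z
  proof -
    have "cmod (g z + h z) powr p \<le> (cmod (g z) + cmod (h z)) powr p"
      using p by (intro powr_mono2 norm_triangle_ineq) auto
    also have "\<dots> \<le> (A + A') powr (p - 1) * (A * (cmod (g z) / A) powr p + A' * (cmod (h z) / A') powr p)"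
      using p A A' by (intro powr_add_convex) auto
    also have "\<dots> = (A + A') powr (p - 1) * A / A powr p * cmod (g z) powr p + (A + A') powr (p - 1) * A' / A' powr p * cmod (h z) powr p"
      using A A' by (simp add: powr_divide algebra_simps)
    finally show ?thesis .
  qed
  let ?a = "(A + A') powr (p - 1) * A / A powr p" and ?b = "(A + A') powr (p - 1) * A' / A' powr p"
  have "(\<integral>\<^sup>+z. ennreal (cmod (g z + h z) powr p) \<partial>bergman_measure \<alpha>)
      \<le> (\<integral>\<^sup>+z. ennreal ?a * ennreal (cmod (g z) powr p) + ennreal ?b * ennreal (cmod (h z) powr p) \<partial>bergman_measure \<alpha>)"
    using pt A A' by (intro nn_integral_mono) (simp add: ennreal_mult[symmetric] ennreal_plus[symmetric] del: ennreal_plus)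
  also have "\<dots> = ennreal ?a * (\<integral>\<^sup>+z. ennreal (cmod (g z) powr p) \<partial>bergman_measure \<alpha>)
      + ennreal ?b * (\<integral>\<^sup>+z. ennreal (cmod (h z) powr p) \<partial>bergman_measure \<alpha>)"
    by (simp add: nn_integral_add nn_integral_cmult)
  also have "\<dots> \<le> ennreal ?a * ennreal (A powr p) + ennreal ?b * ennreal (A' powr p)"
    using g h unfolding bergman_le_def by (intro add_mono mult_left_mono) auto
  also have "\<dots> = ennreal (?a * A powr p + ?b * A' powr p)"
    using A A' by (simp add: ennreal_mult[symmetric] ennreal_plus[symmetric] del: ennreal_plus)
  also have "?a * A powr p + ?b * A' powr p = (A + A') powr (p - 1) * (A + A')"
    using A A' by (simp add: algebra_simps)
  also have "\<dots> = (A + A') powr p"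
    using A A' by (simp add: powr_diff)
  finally show ?thesis
    unfolding bergman_le_def using A A' by auto
qed

text \<open>A bound may be 0, where division by it fails, so both are enlarged by e/2 before
  \<open>bergman_le_add_pos\<close> is applied.\<close>

lemma bergman_norm_add_le:
  assumes p: "1 < p" and g: "bergman_le p \<alpha> A g" and h: "bergman_le p \<alpha> A' h"
  shows "bergman_norm p \<alpha> (\<lambda>z. g z + h z) \<le> A + A'"
proof (rule field_le_epsilon)
  fix e :: real assume e: "e > 0"
  have "0 \<le> A" "0 \<le> A'" using g h unfolding bergman_le_def by auto
  then have "bergman_le p \<alpha> ((A + e / 2) + (A' + e / 2)) (\<lambda>z. g z + h z)"
    using e p by (intro bergman_le_add_pos bergman_le_mono[OF g] bergman_le_mono[OF h]) auto
  then have "bergman_norm p \<alpha> (\<lambda>z. g z + h z) \<le> A + e / 2 + (A' + e / 2)"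
    by (rule bergman_norm_leI) (use p in simp)
  then show "bergman_norm p \<alpha> (\<lambda>z. g z + h z) \<le> A + A' + e"
    by simp
qed

lemma bergman_le_add:
  assumes p: "1 < p" and g: "bergman_le p \<alpha> A g" and h: "bergman_le p \<alpha> A' h"
  shows "bergman_le p \<alpha> (A + A') (\<lambda>z. g z + h z)"
proof (rule bergman_leI)
  show "bergman_norm p \<alpha> (\<lambda>z. g z + h z) \<le> A + A'"
    by (rule bergman_norm_add_le[OF p g h])
  have "0 \<le> A" "0 \<le> A'" using g h unfolding bergman_le_def by auto
  \<comment> \<open>Any positive bounds serve here, as only measurability and integrability are
    extracted.\<close>
  then have "bergman_le p \<alpha> ((A + 1) + (A' + 1)) (\<lambda>z. g z + h z)"
    using p by (intro bergman_le_add_pos bergman_le_mono[OF g] bergman_le_mono[OF h]) auto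
  then show "(\<lambda>z. g z + h z) \<in> borel_measurable (bergman_measure \<alpha>)"
    and "integrable (bergman_measure \<alpha>) (\<lambda>z. cmod (g z + h z) powr p)"
    using bergman_le_integrable unfolding bergman_le_def by auto
qed (use p in simp)

lemma bergman_le_cmult:
  assumes g: "bergman_le p \<alpha> M g"
  shows "bergman_le p \<alpha> (cmod c * M) (\<lambda>z. c * g z)"
proof -
  have [measurable]: "g \<in> borel_measurable (bergman_measure \<alpha>)" and M: "0 \<le> M"
    using g unfolding bergman_le_def by auto
  have "(\<integral>\<^sup>+z. ennreal (cmod (c * g z) powr p) \<partial>bergman_measure \<alpha>)
      = ennreal (cmod c powr p) * (\<integral>\<^sup>+z. ennreal (cmod (g z) powr p) \<partial>bergman_measure \<alpha>)"
    by (subst nn_integral_cmult[symmetric]) (auto simp: norm_mult powr_mult ennreal_mult)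
  also have "\<dots> \<le> ennreal (cmod c powr p) * ennreal (M powr p)"
    using g unfolding bergman_le_def by (intro mult_left_mono) auto
  also have "\<dots> = ennreal ((cmod c * M) powr p)"
    using M by (simp add: powr_mult ennreal_mult)
  finally show ?thesis
    unfolding bergman_le_def using M by simp
qed

lemma bergman_norm_cong:
  assumes "\<And>z. cmod z < 1 \<Longrightarrow> g z = h z"
  shows "bergman_norm p \<alpha> g = bergman_norm p \<alpha> h"
proof -
  have "(\<integral>z. cmod (g z) powr p \<partial>bergman_measure \<alpha>) = (\<integral>z. cmod (h z) powr p \<partial>bergman_measure \<alpha>)"
    by (rule Bochner_Integration.integral_cong) (use assms in auto)
  then show ?thesis unfolding bergman_norm_def by simp
qed

section \<open>Power series in the disc\<close>

text \<open>A relation between coefficients and functions lets every operation on functions be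
  tracked as a multiplier on coefficients. Values outside the disc stay unconstrained.\<close>

definition power_series :: "(nat \<Rightarrow> complex) \<Rightarrow> (complex \<Rightarrow> complex) \<Rightarrow> bool" where
  "power_series a g \<longleftrightarrow> (\<forall>z. cmod z < 1 \<longrightarrow> (\<lambda>m. a m * z ^ m) sums g z)"

lemma power_seriesD: "power_series a g \<Longrightarrow> cmod z < 1 \<Longrightarrow> (\<lambda>m. a m * z ^ m) sums g z"
  unfolding power_series_def by blast

text \<open>The series converges at a point of larger modulus that is still below 1, which gives
  absolute convergence at \<open>z\<close>.\<close>

lemma power_series_abs_summable:
  assumes "power_series a g" "cmod z < 1"
  shows "summable (\<lambda>m. cmod (a m) * cmod z ^ m)"
proof -
  obtain x where x: "cmod z < x" "x < 1" using assms(2) dense by blast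
  then have "cmod (complex_of_real x) < 1" "cmod z < cmod (complex_of_real x)"
    using norm_ge_zero[of z] by (auto simp del: norm_ge_zero)
  from powser_insidea[OF sums_summable[OF power_seriesD[OF assms(1) this(1)]] this(2)]
  show ?thesis by (simp add: norm_mult norm_power)
qed

lemma power_series_holomorphic_on: "power_series a g \<Longrightarrow> g holomorphic_on ball 0 1"
  by (rule power_series_holomorphic[of 0 1 a]) (auto dest: power_seriesD)

lemma power_series_continuous_on: "power_series a g \<Longrightarrow> continuous_on (ball 0 1) g"
  using power_series_holomorphic_on holomorphic_on_imp_continuous_on by blast

lemma power_series_rotate:
  assumes "power_series a g"
  shows "power_series (\<lambda>m. a m * cis (real m * t)) (\<lambda>z. g (cis t * z))"
  unfolding power_series_def
proof (intro allI impI)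
  fix z :: complex assume "cmod z < 1"
  then have "(\<lambda>m. a m * (cis t * z) ^ m) sums g (cis t * z)"
    by (intro power_seriesD[OF assms]) (simp add: norm_mult)
  then show "(\<lambda>m. a m * cis (real m * t) * z ^ m) sums g (cis t * z)"
    unfolding power_mult_distrib Complex.DeMoivre by (simp only: mult_ac)
qed

lemma power_series_add:
  "power_series a g \<Longrightarrow> power_series b h \<Longrightarrow> power_series (\<lambda>m. a m + b m) (\<lambda>z. g z + h z)"
  unfolding power_series_def by (auto simp: distrib_right intro!: sums_add)

lemma power_series_cmult: "power_series a g \<Longrightarrow> power_series (\<lambda>m. c * a m) (\<lambda>z. c * g z)"
  unfolding power_series_def by (auto simp: mult.assoc intro!: sums_mult)

lemma power_series_diff:
  "power_series a g \<Longrightarrow> power_series b h \<Longrightarrow> power_series (\<lambda>m. a m - b m) (\<lambda>z. g z - h z)"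
  unfolding power_series_def by (auto simp: left_diff_distrib intro!: sums_diff)

text \<open>An average of rotations multiplies the m-th coefficient by the Fourier transform of
  \<open>k\<close> at cm. Termwise integration is justified because rotations leave the moduli of
  the terms unchanged.\<close>

lemma power_series_convolution:
  assumes g: "power_series a g" and k: "integrable lborel k"
  shows "power_series (\<lambda>m. (\<integral>t. k t * cis (real m * (c * t)) \<partial>lborel) * a m)
    (\<lambda>z. \<integral>t. k t * g (cis (c * t) * z) \<partial>lborel)"
  unfolding power_series_def
proof (intro allI impI)
  fix z :: complex assume z: "cmod z < 1"
  let ?f = "\<lambda>m t. k t * cis (real m * (c * t)) * (a m * z ^ m)"
  have [measurable]: "k \<in> borel_measurable borel" using k by auto
  have norm: "cmod (?f m t) = cmod (k t) * (cmod (a m) * cmod z ^ m)" for m t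
    by (simp add: norm_mult norm_power)
  have cis [measurable]: "(\<lambda>t. cis (real m * (c * t))) \<in> borel_measurable borel" for m
    using measurable_cis_mult[of "real m * c"] by (simp add: mult.assoc)
  have int: "integrable lborel (\<lambda>t. k t * cis (real m * (c * t)))" for m
    by (rule Bochner_Integration.integrable_bound[OF k]) (auto simp: norm_mult)
  have "(\<lambda>m. \<integral>t. ?f m t \<partial>lborel) sums (\<integral>t. (\<Sum>m. ?f m t) \<partial>lborel)"
  proof (rule sums_integral)
    show "integrable lborel (?f m)" for m
      using int by simp
    show "AE t in lborel. summable (\<lambda>m. cmod (?f m t))"
      unfolding norm by (intro AE_I2 summable_mult power_series_abs_summable[OF g z])
    show "summable (\<lambda>m. \<integral>t. cmod (?f m t) \<partial>lborel)"
      unfolding norm integral_mult_left_zero by (intro summable_mult power_series_abs_summable[OF g z])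
  qed
  also have "(\<integral>t. (\<Sum>m. ?f m t) \<partial>lborel) = (\<integral>t. k t * g (cis (c * t) * z) \<partial>lborel)"
  proof (rule Bochner_Integration.integral_cong[OF refl])
    fix t
    have "(\<lambda>m. k t * (a m * cis (real m * (c * t)) * z ^ m)) sums (k t * g (cis (c * t) * z))"
      by (intro sums_mult power_seriesD[OF power_series_rotate[OF g] z])
    then show "(\<Sum>m. ?f m t) = k t * g (cis (c * t) * z)"
      by (simp add: sums_iff mult_ac)
  qed
  finally show "(\<lambda>m. (\<integral>t. k t * cis (real m * (c * t)) \<partial>lborel) * a m * z ^ m)
      sums (\<integral>t. k t * g (cis (c * t) * z) \<partial>lborel)"
    unfolding integral_mult_left_zero by (simp only: mult.assoc)
qed

lemma measurable_bergman_rotations: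
  assumes "continuous_on (ball 0 1) g"
  shows "(\<lambda>(t, z). g (cis (c * t) * z)) \<in> borel_measurable (lborel \<Otimes>\<^sub>M bergman_measure \<alpha>)"
proof -
  have [measurable]: "(\<lambda>z. z) \<in> borel_measurable (bergman_measure \<alpha>)"
    by (rule measurable_bergman_continuous) (rule continuous_on_id)
  have "(\<lambda>x. cis (c * fst x) * snd x) \<in> borel_measurable (lborel \<Otimes>\<^sub>M bergman_measure \<alpha>)"
    by measurable
  then have "(\<lambda>x. cis (c * fst x) * snd x) \<in> measurable (lborel \<Otimes>\<^sub>M bergman_measure \<alpha>) (restrict_space borel (ball 0 1))"
    by (rule measurable_restrict_space2[rotated]) (auto simp: space_pair_measure norm_mult)
  from measurable_compose[OF this borel_measurable_continuous_on_restrict[OF assms]]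
  show ?thesis by (simp add: case_prod_beta)
qed

lemma bergman_le_convolution:
  assumes "1 < p" "power_series a g" "bergman_le p \<alpha> M g" "integrable lborel k"
    and "(\<integral>t. cmod (k t) \<partial>lborel) \<le> m"
  shows "bergman_le p \<alpha> (m * M) (\<lambda>z. \<integral>t. k t * g (cis (c * t) * z) \<partial>lborel)"
  using assms measurable_bergman_rotations[OF power_series_continuous_on[OF assms(2)], of c \<alpha>]
  by (intro bergman_le_integral bergman_le_rotate lborel.sigma_finite_measure_axioms)
     (auto simp: bergman_le_def)

section \<open>The de la Vallee-Poussin multiplier and its error\<close>

definition phi :: "real \<Rightarrow> real" where
  "phi x = 4 / pi * Re (FH 0 x)"

lemma phi_eq_0: "2 \<le> x \<Longrightarrow> phi x = 0"
  by (simp add: phi_def Re_FH_0)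

lemma FH_uminus: "FH k (- x) = cnj (FH k x)"
proof -
  have "cnj (FH k x) = (LINT t:{0..}|lborel. cnj (H k t *\<^sub>R cis (x * t)))"
    using Bochner_Integration.integral_cnj[of lborel "\<lambda>t. indicator {0..} t *\<^sub>R (H k t *\<^sub>R cis (x * t))"]
    unfolding FH_def set_lebesgue_integral_def by (simp del: H.simps Bochner_Integration.integral_cnj)
  then show ?thesis by (simp add: FH_def cis_cnj del: H.simps)
qed

text \<open>A real part is not a combination of rotations, but half the sum with the conjugate is.
  As the kernel is real, conjugation flips the frequency, and conjugating the power of ix produces
  the sign.\<close>

lemma FH_multiplier:
  "- (2 / pi) * (\<i> * complex_of_real x) ^ Suc k * (FH (Suc k) x + (- 1) ^ Suc k * FH (Suc k) (- x))
    = of_real (1 - phi x)"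
proof -
  let ?w = "(\<i> * complex_of_real x) ^ Suc k * FH (Suc k) x"
  have "cnj ?w = (- (\<i> * complex_of_real x)) ^ Suc k * FH (Suc k) (- x)"
    by (simp add: FH_uminus)
  also have "\<dots> = (\<i> * complex_of_real x) ^ Suc k * ((- 1) ^ Suc k * FH (Suc k) (- x))"
    by (subst power_minus) (simp add: mult_ac)
  finally have "(\<i> * complex_of_real x) ^ Suc k * (FH (Suc k) x + (- 1) ^ Suc k * FH (Suc k) (- x)) = ?w + cnj ?w"
    by (simp only: distrib_left)
  also have "\<dots> = of_real (2 * Re ?w)"
    by (rule complex_add_cnj)
  also have "Re ?w = pi / 4 * phi x - pi / 4"
  proof -
    have "pi / 4 * phi x = Re (FH 0 x)" by (simp add: phi_def)
    then show ?thesis using Re_FH_0_eq[of x k] by linarith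
  qed
  finally have "(\<i> * complex_of_real x) ^ Suc k * (FH (Suc k) x + (- 1) ^ Suc k * FH (Suc k) (- x))
      = of_real (2 * (pi / 4 * phi x - pi / 4))" .
  then have "- (2 / pi) * ((\<i> * complex_of_real x) ^ Suc k * (FH (Suc k) x + (- 1) ^ Suc k * FH (Suc k) (- x)))
      = of_real (- (2 / pi) * (2 * (pi / 4 * phi x - pi / 4)))"
    by simp
  also have "- (2 / pi) * (2 * (pi / 4 * phi x - pi / 4)) = 1 - phi x"
    by (simp add: field_simps)
  finally show ?thesis by (simp add: mult.assoc)
qed

text \<open>\<open>a\<close> holds the coefficients of the function to be approximated, and
  \<open>g\<close> is its angular derivative of order \<open>Suc k\<close>. By
  \<open>FH_multiplier\<close> the error is an average of forward and backward rotations of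
  \<open>g\<close>.\<close>

lemma approximation_error:
  assumes p: "1 < p" and c: "0 \<le> c" and M: "bergman_le p \<alpha> M g"
    and g: "power_series (\<lambda>m. (\<i> * of_nat m) ^ Suc k * a m) g"
  shows "\<exists>e. bergman_le p \<alpha> (c ^ Suc k * C (Suc k) * M) e \<and>
    power_series (\<lambda>m. of_real (1 - phi (c * real m)) * a m) e"
proof -
  \<comment> \<open>The constant 2/pi is half of the 4/pi in \<open>C\<close>, as each direction of
    rotation carries half the mass. The power of \<open>c\<close> comes from the power of icm, and
    \<open>s\<close> is a sign.\<close>
  define kp where "kp s t = complex_of_real (s * (2 / pi * c ^ Suc k)) * (indicator {0..} t *\<^sub>R complex_of_real (H (Suc k) t))"
    for s t :: real
  have intH: "integrable lborel (\<lambda>t. indicator {0..} t *\<^sub>R H (Suc k) t)"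
    using set_integrable_H unfolding set_integrable_def .
  have int: "integrable lborel (kp s)" for s
    using intH unfolding kp_def
    by (intro integrable_mult_right) (simp add: scaleR_conv_of_real integrable_of_real flip: of_real_mult del: H.simps)
  have nrm: "(\<integral>t. cmod (kp s t) \<partial>lborel) \<le> c ^ Suc k * C (Suc k) / 2" if "\<bar>s\<bar> = 1" for s
  proof -
    have "cmod (kp s t) = (2 / pi * c ^ Suc k) * (indicator {0..} t *\<^sub>R \<bar>H (Suc k) t\<bar>)" for t
      using that c by (simp add: kp_def norm_mult norm_power abs_mult norm_divide del: H.simps)
    then have "(\<integral>t. cmod (kp s t) \<partial>lborel) = (2 / pi * c ^ Suc k) * (LINT t:{0..}|lborel. \<bar>H (Suc k) t\<bar>)"
      unfolding set_lebesgue_integral_def by (simp del: H.simps)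
    also have "\<dots> = c ^ Suc k * C (Suc k) / 2"
      by (simp add: C_def del: H.simps)
    finally show ?thesis by simp
  qed
  have coeff: "(\<integral>t. kp s t * cis (real m * (c' * t)) \<partial>lborel)
      = of_real (s * (2 / pi * c ^ Suc k)) * FH (Suc k) (c' * real m)" for s c' m
  proof -
    have "kp s t * cis (real m * (c' * t)) = of_real (s * (2 / pi * c ^ Suc k)) *
        (indicator {0..} t *\<^sub>R (H (Suc k) t *\<^sub>R cis (c' * real m * t)))" for t
      by (simp add: kp_def scaleR_conv_of_real mult_ac del: H.simps)
    then have "(\<integral>t. kp s t * cis (real m * (c' * t)) \<partial>lborel)
        = (\<integral>t. of_real (s * (2 / pi * c ^ Suc k)) *
          (indicator {0..} t *\<^sub>R (H (Suc k) t *\<^sub>R cis (c' * real m * t))) \<partial>lborel)"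
      by (intro Bochner_Integration.integral_cong refl)
    then show ?thesis
      unfolding FH_def set_lebesgue_integral_def by (simp only: integral_mult_right_zero)
  qed
  \<comment> \<open>The sign of the backward rotation: the -1 in front of
    \<open>FH_multiplier\<close> times the power of -1 inside.\<close>
  define sg :: real where "sg = - ((- 1) ^ Suc k)"
  have sg: "\<bar>sg\<bar> = 1" by (simp add: sg_def power_abs)
  define e where "e z = (\<integral>t. kp (- 1) t * g (cis (c * t) * z) \<partial>lborel) + (\<integral>t. kp sg t * g (cis (- c * t) * z) \<partial>lborel)" for z
  have "bergman_le p \<alpha> (c ^ Suc k * C (Suc k) / 2 * M + c ^ Suc k * C (Suc k) / 2 * M) e"
    unfolding e_def using sg
    by (intro bergman_le_add[OF p] bergman_le_convolution[OF p g M int] nrm) auto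
  also have "c ^ Suc k * C (Suc k) / 2 * M + c ^ Suc k * C (Suc k) / 2 * M = c ^ Suc k * C (Suc k) * M"
    by (simp only: distrib_right[symmetric] field_sum_of_halves)
  finally have "bergman_le p \<alpha> (c ^ Suc k * C (Suc k) * M) e" .
  moreover have "power_series (\<lambda>m. of_real (1 - phi (c * real m)) * a m) e"
  proof -
    have "power_series (\<lambda>m. (\<integral>t. kp (- 1) t * cis (real m * (c * t)) \<partial>lborel) * ((\<i> * of_nat m) ^ Suc k * a m)
        + (\<integral>t. kp sg t * cis (real m * (- c * t)) \<partial>lborel) * ((\<i> * of_nat m) ^ Suc k * a m)) e"
      unfolding e_def by (intro power_series_add power_series_convolution g int)
    moreover have "(\<integral>t. kp (- 1) t * cis (real m * (c * t)) \<partial>lborel) * ((\<i> * of_nat m) ^ Suc k * a m)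
        + (\<integral>t. kp sg t * cis (real m * (- c * t)) \<partial>lborel) * ((\<i> * of_nat m) ^ Suc k * a m)
        = of_real (1 - phi (c * real m)) * a m" for m
    proof -
      have pw: "(\<i> * complex_of_real (c * real m)) ^ Suc k = of_real (c ^ Suc k) * (\<i> * of_nat m) ^ Suc k"
        by (simp only: of_real_mult of_real_of_nat_eq power_mult_distrib of_real_power mult_ac)
      have eq: "of_real (1 - phi (c * real m)) * a m = - (2 / pi) * (of_real (c ^ Suc k) * (\<i> * of_nat m) ^ Suc k)
          * (FH (Suc k) (c * real m) + (- 1) ^ Suc k * FH (Suc k) (- (c * real m))) * a m"
        unfolding FH_multiplier[of "c * real m" k, symmetric] pw ..
      have cf: "complex_of_real (s * (2 / pi * c ^ Suc k)) = complex_of_real s * (complex_of_real (2 / pi) * complex_of_real (c ^ Suc k))" for s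
        by (simp only: of_real_mult mult.assoc)
      have sgn: "complex_of_real (- 1) = - 1" "complex_of_real (- ((- 1) ^ Suc k)) = - ((- 1) ^ Suc k)"
        by simp_all
      \<comment> \<open>Powers and transforms are abstracted to variables, which leaves a plain ring
        identity.\<close>
      have gen: "- 1 * (d * q) * x * (P * y) + - u * (d * q) * x' * (P * y) = - d * (q * P) * (x + u * x') * y"
        for d q x x' P u y :: complex
        by (simp add: algebra_simps)
      show ?thesis
        unfolding eq coeff unfolding sg_def cf sgn mult_minus_left[of c] of_real_minus[of "2 / pi"] gen ..
    qed
    ultimately show ?thesis by simp
  qed
  ultimately show ?thesis by blast
qed

text \<open>By the chain rule the angular derivative is iz d/dz, which multiplies the m-th
  coefficient by im.\<close>

lemma power_series_angular_derivative:
  assumes g: "power_series a g"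
  shows "power_series (\<lambda>m. \<i> * of_nat m * a m) (\<lambda>z. \<i> * z * deriv g z)"
    and "0 \<le> r \<Longrightarrow> r < 1 \<Longrightarrow> ((\<lambda>\<theta>. g (complex_of_real r * cis \<theta>)) has_vector_derivative
      \<i> * (of_real r * cis \<theta>) * deriv g (of_real r * cis \<theta>)) (at \<theta>)"
proof -
  note sm = sums_summable[OF power_seriesD[OF g]]
  have D: "(g has_field_derivative (\<Sum>n. diffs a n * z ^ n)) (at z)" if z: "cmod z < 1" for z
  proof -
    have "((\<lambda>z. \<Sum>n. a n * z ^ n) has_field_derivative (\<Sum>n. diffs a n * z ^ n)) (at z)"
      by (rule termdiffs_strong'[of 1]) (use sm z in auto)
    then show ?thesis
      by (rule has_field_derivative_transform_within_open[of _ _ _ "ball 0 1"])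
         (use z power_seriesD[OF g] in \<open>auto simp: sums_iff\<close>)
  qed
  show "power_series (\<lambda>m. \<i> * of_nat m * a m) (\<lambda>z. \<i> * z * deriv g z)"
    unfolding power_series_def
  proof (intro allI impI)
    fix z :: complex assume z: "cmod z < 1"
    have "summable (\<lambda>n. diffs a n * z ^ n)"
      by (rule termdiff_converges[OF z]) (use sm in auto)
    from diffs_equiv[OF this] have "(\<lambda>n. of_nat n * a n * z ^ (n - Suc 0)) sums deriv g z"
      using DERIV_imp_deriv[OF D[OF z]] by simp
    then have "(\<lambda>n. \<i> * z * (of_nat n * a n * z ^ (n - Suc 0))) sums (\<i> * z * deriv g z)"
      by (rule sums_mult)
    \<comment> \<open>For n = 0 the exponent is truncated to 0, but the factor n annihilates both
      sides.\<close>
    moreover have "\<i> * z * (of_nat n * a n * z ^ (n - Suc 0)) = \<i> * of_nat n * a n * z ^ n" for n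
      by (cases n) auto
    ultimately show "(\<lambda>m. \<i> * of_nat m * a m * z ^ m) sums (\<i> * z * deriv g z)"
      by simp
  qed
  assume r: "0 \<le> r" "r < 1"
  let ?w = "complex_of_real r * cis \<theta>"
  have w: "cmod ?w < 1" using r by (simp add: norm_mult)
  have D1: "((\<lambda>\<theta>. complex_of_real r * cis \<theta>) has_vector_derivative of_real r * (\<i> * cis \<theta>)) (at \<theta>)"
    using has_vector_derivative_mult_right[OF cis_has_vector_derivative[of 1 \<theta>], of "of_real r"] by simp
  have D2: "(g has_field_derivative deriv g ?w) (at ?w)"
    using D[OF w] DERIV_imp_deriv[OF D[OF w]] by simp
  show "((\<lambda>\<theta>. g (complex_of_real r * cis \<theta>)) has_vector_derivative \<i> * ?w * deriv g ?w) (at \<theta>)"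
    using field_vector_diff_chain_at[OF D1 D2]
    by (simp add: o_def mult_ac)
qed

text \<open>\<open>angular_deriv\<close> differentiates repeatedly along one circle before
  evaluating at \<open>Arg z\<close>. The induction therefore identifies whole functions of the
  angle, on each circle of radius below 1.\<close>

lemma power_series_angular_deriv:
  assumes f: "power_series a f"
  shows "power_series (\<lambda>m. (\<i> * of_nat m) ^ k * a m) (angular_deriv k f)"
proof -
  have "\<exists>g. power_series (\<lambda>m. (\<i> * of_nat m) ^ k * a m) g \<and>
      (\<forall>r. 0 \<le> r \<longrightarrow> r < 1 \<longrightarrow> ((\<lambda>u \<theta>. vector_derivative u (at \<theta>)) ^^ k)
        (\<lambda>\<theta>::real. f (complex_of_real r * cis \<theta>)) = (\<lambda>\<theta>. g (of_real r * cis \<theta>)))"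
  proof (induction k)
    case 0
    show ?case using f by (intro exI[of _ f]) simp
  next
    case (Suc k)
    then obtain g where g: "power_series (\<lambda>m. (\<i> * of_nat m) ^ k * a m) g"
      and eq: "\<And>r. 0 \<le> r \<Longrightarrow> r < 1 \<Longrightarrow> ((\<lambda>u \<theta>. vector_derivative u (at \<theta>)) ^^ k)
        (\<lambda>\<theta>::real. f (complex_of_real r * cis \<theta>)) = (\<lambda>\<theta>. g (of_real r * cis \<theta>))"
      by blast
    show ?case
    proof (intro exI conjI allI impI)
      show "power_series (\<lambda>m. (\<i> * of_nat m) ^ Suc k * a m) (\<lambda>z. \<i> * z * deriv g z)"
        using power_series_angular_derivative(1)[OF g] by (simp add: mult_ac)
      fix r :: real assume r: "0 \<le> r" "r < 1"
      show "((\<lambda>u \<theta>. vector_derivative u (at \<theta>)) ^^ Suc k) (\<lambda>\<theta>::real. f (complex_of_real r * cis \<theta>))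
          = (\<lambda>\<theta>. \<i> * (of_real r * cis \<theta>) * deriv g (of_real r * cis \<theta>))"
        using vector_derivative_at[OF power_series_angular_derivative(2)[OF g r]]
        by (simp add: eq[OF r])
    qed
  qed
  then obtain g where g: "power_series (\<lambda>m. (\<i> * of_nat m) ^ k * a m) g"
    and eq: "\<And>r. 0 \<le> r \<Longrightarrow> r < 1 \<Longrightarrow> ((\<lambda>u \<theta>. vector_derivative u (at \<theta>)) ^^ k)
      (\<lambda>\<theta>::real. f (complex_of_real r * cis \<theta>)) = (\<lambda>\<theta>. g (of_real r * cis \<theta>))"
    by blast
  have "angular_deriv k f z = g z" if "cmod z < 1" for z
    using eq[of "cmod z"] that rcis_cmod_Arg[of z] by (simp add: angular_deriv_def rcis_def)
  then show ?thesis
    using g by (simp add: power_series_def)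
qed

section \<open>Approximation\<close>

text \<open>The supremum dominates its members because the set is bounded: Minkowski and rotation
  invariance give twice the norm of \<open>g\<close>.\<close>

lemma bergman_modulus_upper:
  assumes p: "1 < p" and g: "g \<in> bergman_space p \<alpha>" and t: "\<bar>t\<bar> \<le> \<delta>"
  shows "bergman_le p \<alpha> (bergman_modulus p \<alpha> \<delta> g) (\<lambda>z. g (cis t * z) - g z)"
proof -
  have "g \<in> borel_measurable (bergman_measure \<alpha>)"
    using g by (intro measurable_bergman_continuous)
      (auto simp: bergman_space_def intro: holomorphic_on_imp_continuous_on)
  then have le: "bergman_le p \<alpha> (bergman_norm p \<alpha> g) g"
    using g p by (intro bergman_leI) (auto simp: bergman_space_def)
  define M where "M = bergman_norm p \<alpha> g + bergman_norm p \<alpha> g"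
  have diff: "bergman_le p \<alpha> M (\<lambda>z. g (cis s * z) - g z)" for s
    using bergman_le_add[OF p bergman_le_rotate[OF le, of s] bergman_le_cmult[OF le, of "- 1"]]
    by (simp add: M_def)
  have "bdd_above ((\<lambda>t. bergman_norm p \<alpha> (\<lambda>z. g (cis t * z) - g z)) ` {t. \<bar>t\<bar> \<le> \<delta>})"
    using bergman_norm_leI[OF diff] p by (intro bdd_aboveI2[of _ _ M]) auto
  then have "bergman_norm p \<alpha> (\<lambda>z. g (cis t * z) - g z) \<le> bergman_modulus p \<alpha> \<delta> g"
    unfolding bergman_modulus_def using t by (intro cSUP_upper) auto
  then show ?thesis
    using diff[of t] bergman_le_integrable[OF diff[of t]] p unfolding bergman_le_def
    by (intro bergman_leI[unfolded bergman_le_def]) auto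
qed

section \<open>The mean over rotations by angles in [0, \<delta>]\<close>

definition mean_kernel :: "real \<Rightarrow> real \<Rightarrow> complex" where
  "mean_kernel \<delta> t = indicator {0..\<delta>} t *\<^sub>R complex_of_real (1 / \<delta>)"

definition mean_coeff :: "real \<Rightarrow> nat \<Rightarrow> complex" where
  "mean_coeff \<delta> m = (\<integral>t. mean_kernel \<delta> t * cis (real m * t) \<partial>lborel)"

lemma mean_kernel:
  assumes "\<delta> > 0"
  shows "integrable lborel (mean_kernel \<delta>)"
    and "(\<integral>t. mean_kernel \<delta> t \<partial>lborel) = 1"
    and "(\<integral>t. cmod (mean_kernel \<delta> t) \<partial>lborel) = 1"
proof -
  show "integrable lborel (mean_kernel \<delta>)"
    unfolding mean_kernel_def by (intro integrable_scaleR_left integrable_real_indicator)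
      (use assms in \<open>auto simp: emeasure_lborel_Icc_eq\<close>)
  show "(\<integral>t. mean_kernel \<delta> t \<partial>lborel) = 1"
    unfolding mean_kernel_def using assms by (simp add: scaleR_conv_of_real)
  have "cmod (mean_kernel \<delta> t) = indicator {0..\<delta>} t *\<^sub>R (1 / \<delta>)" for t
    using assms by (simp add: mean_kernel_def norm_divide)
  then show "(\<integral>t. cmod (mean_kernel \<delta> t) \<partial>lborel) = 1"
    using assms by simp
qed

text \<open>Differentiating the mean in the angle gives a difference quotient. The form without
  division by m covers m = 0.\<close>

lemma mean_coeff:
  assumes "\<delta> > 0"
  shows "\<i> * of_nat m * mean_coeff \<delta> m = (cis (real m * \<delta>) - 1) / \<delta>"
proof -
  have "(\<integral>t. indicator {0..\<delta>} t *\<^sub>R (\<i> * real m * cis (real m * t)) \<partial>lborel)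
      = cis (real m * \<delta>) - cis (real m * 0)"
    by (rule integral_FTC_atLeastAtMost)
       (use assms cis_has_vector_derivative[of "real m"] in \<open>auto intro!: continuous_intros continuous_at_imp_continuous_on
          simp: isCont_cis intro: has_vector_derivative_at_within\<close>)
  moreover have "mean_kernel \<delta> t * cis (real m * t) * (\<i> * of_nat m * \<delta>)
      = indicator {0..\<delta>} t *\<^sub>R (\<i> * real m * cis (real m * t))" for t
    using assms by (simp add: mean_kernel_def)
  then have "(\<integral>t. indicator {0..\<delta>} t *\<^sub>R (\<i> * real m * cis (real m * t)) \<partial>lborel)
      = mean_coeff \<delta> m * (\<i> * of_nat m * \<delta>)"
    unfolding mean_coeff_def by (simp only: integral_mult_left_zero[symmetric])
  ultimately show ?thesis
    using assms by (simp add: field_simps)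
qed

text \<open>The kernel has mass 1, so \<open>g\<close> minus its mean is the average of the
  differences between \<open>g\<close> and its rotations, each bounded by \<open>M\<close>.\<close>

lemma mean_difference:
  assumes p: "1 < p" and \<delta>: "\<delta> > 0" and g: "power_series a g"
    and le: "\<And>t. 0 \<le> t \<Longrightarrow> t \<le> \<delta> \<Longrightarrow> bergman_le p \<alpha> M (\<lambda>z. g (cis t * z) - g z)"
  shows "\<exists>e. bergman_le p \<alpha> M e \<and> power_series (\<lambda>m. (1 - mean_coeff \<delta> m) * a m) e"
proof -
  define e where "e z = g z - (\<integral>t. mean_kernel \<delta> t * g (cis (1 * t) * z) \<partial>lborel)" for z
  have "power_series (\<lambda>m. a m - (\<integral>t. mean_kernel \<delta> t * cis (real m * (1 * t)) \<partial>lborel) * a m) e"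
    unfolding e_def by (intro power_series_diff power_series_convolution g mean_kernel \<delta>)
  then have ps: "power_series (\<lambda>m. (1 - mean_coeff \<delta> m) * a m) e"
    by (simp add: mean_coeff_def left_diff_distrib)
  have M: "0 \<le> M" using le[of 0] \<delta> unfolding bergman_le_def by auto
  \<comment> \<open>\<open>bergman_le_integral\<close> demands the bound for every \<open>t\<close>,
    whereas \<open>le\<close> gives it on [0, \<delta>]. The cutoff does not alter the integral,
    because the kernel vanishes elsewhere.\<close>
  define F where "F t z = indicator {0..\<delta>} t *\<^sub>R (g (cis (1 * t) * z) - g z)" for t z
  note cont = power_series_continuous_on[OF g]
  note [measurable] = measurable_bergman_rotations[OF cont, of 1 \<alpha>] measurable_bergman_continuous[OF cont, of \<alpha>]
  have "case_prod F \<in> borel_measurable (lborel \<Otimes>\<^sub>M bergman_measure \<alpha>)"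
    unfolding F_def by measurable
  moreover have "bergman_le p \<alpha> M (F t)" for t
  proof (cases "t \<in> {0..\<delta>}")
    case True
    then show ?thesis using le[of t] by (simp add: F_def[abs_def])
  next
    case False
    then show ?thesis using M by (simp add: F_def[abs_def] bergman_le_def)
  qed
  ultimately have "bergman_le p \<alpha> (1 * M) (\<lambda>z. \<integral>t. mean_kernel \<delta> t * F t z \<partial>lborel)"
    using mean_kernel[OF \<delta>] M p by (intro bergman_le_integral lborel.sigma_finite_measure_axioms) auto
  from bergman_le_cmult[OF this, of "- 1"]
  have le': "bergman_le p \<alpha> M (\<lambda>z. - (\<integral>t. mean_kernel \<delta> t * F t z \<partial>lborel))" by simp
  have "- (\<integral>t. mean_kernel \<delta> t * F t z \<partial>lborel) = e z" if z: "cmod z < 1" for z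
  proof -
    \<comment> \<open>Continuity in \<open>t\<close> makes the first summand integrable over the
      compact interval, so the integral can be split.\<close>
    have "continuous_on UNIV (\<lambda>t. g (cis t * z))"
      by (rule continuous_on_compose2[OF cont])
         (use z isCont_cis[where x = 1, simplified] in \<open>auto intro!: continuous_intros continuous_at_imp_continuous_on simp: norm_mult\<close>)
    then have "set_integrable lborel {0..\<delta>} (\<lambda>t. (1 / \<delta>) *\<^sub>R g (cis t * z))"
      by (intro borel_integrable_atLeastAtMost' continuous_intros) (auto intro: continuous_on_subset)
    then have int: "integrable lborel (\<lambda>t. mean_kernel \<delta> t * g (cis t * z))"
      by (simp add: set_integrable_def mean_kernel_def scaleR_conv_of_real mult_ac)
    have "mean_kernel \<delta> t * F t z = mean_kernel \<delta> t * g (cis t * z) - mean_kernel \<delta> t * g z" for t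
      by (simp add: F_def mean_kernel_def indicator_def algebra_simps)
    then have "(\<integral>t. mean_kernel \<delta> t * F t z \<partial>lborel) = (\<integral>t. mean_kernel \<delta> t * g (cis t * z) \<partial>lborel) - g z"
      using int mean_kernel[OF \<delta>] by simp
    then show ?thesis by (simp add: e_def)
  qed
  with le' have "bergman_le p \<alpha> M e"
    by (rule bergman_le_cong)
  with ps show ?thesis by blast
qed

text \<open>Since e + e' has the same coefficients as \<open>f\<close> from \<open>n\<close> on, f -
  (e + e') is a polynomial of degree below \<open>n\<close>, and it competes in the infimum.\<close>

lemma best_approx_le:
  assumes p: "1 < p" and f: "power_series a f"
    and e: "power_series b e" "bergman_le p \<alpha> M e" and e': "power_series b' e'" "bergman_le p \<alpha> M' e'"
    and eq: "\<And>m. n \<le> m \<Longrightarrow> b m + b' m = a m"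
  shows "best_approx p \<alpha> n f \<le> M + M'"
proof -
  define Q where "Q = (\<Sum>m<n. monom (a m - (b m + b' m)) m)"
  have deg: "degree Q \<le> n"
    unfolding Q_def by (intro degree_sum_le) (auto intro: order_trans[OF degree_monom_le])
  have "f z - poly Q z = e z + e' z" if z: "cmod z < 1" for z
  proof -
    have "(\<lambda>m. (a m - (b m + b' m)) * z ^ m) sums (f z - (e z + e' z))"
      using power_seriesD[OF power_series_diff[OF f power_series_add[OF e(1) e'(1)]] z] .
    moreover have "(\<lambda>m. (a m - (b m + b' m)) * z ^ m) sums (\<Sum>m<n. (a m - (b m + b' m)) * z ^ m)"
      by (rule sums_finite) (use eq in auto)
    moreover have "poly Q z = (\<Sum>m<n. (a m - (b m + b' m)) * z ^ m)"
      by (simp add: Q_def poly_sum poly_monom)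
    ultimately show ?thesis using sums_unique2 by (metis add_diff_cancel diff_diff_eq2 add.commute)
  qed
  then have "bergman_norm p \<alpha> (\<lambda>z. f z - poly Q z) = bergman_norm p \<alpha> (\<lambda>z. e z + e' z)"
    by (rule bergman_norm_cong)
  moreover have "best_approx p \<alpha> n f \<le> bergman_norm p \<alpha> (\<lambda>z. f z - poly Q z)"
    unfolding best_approx_def
    by (rule cINF_lower) (use deg in \<open>auto intro!: bdd_belowI2[of _ 0] simp: bergman_norm_def\<close>)
  ultimately show ?thesis
    using bergman_norm_add_le[OF p e(2) e'(2)] by simp
qed

theorem theorem2p3:
  fixes p \<alpha> :: real and K n :: nat and f :: "complex \<Rightarrow> complex"
  assumes "1 < p" and "-1 < \<alpha>"
    and "f holomorphic_on ball 0 1"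
    and "f \<in> bergman_space p \<alpha>"
    and "angular_deriv K f \<in> bergman_space p \<alpha>"
    and "1 \<le> n"
  shows "best_approx p \<alpha> n f
           \<le> B K * bergman_modulus p \<alpha> (2 * pi / real n) (angular_deriv K f) / real n ^ K"
proof -
  define \<delta> where "\<delta> = 2 * pi / real n"
  \<comment> \<open>Chosen so that c m is at least 2, hence \<open>phi (c * real m) = 0\<close>,
    from m = n on.\<close>
  define c where "c = 2 / real n"
  define g where "g = angular_deriv K f"
  define \<omega> where "\<omega> = bergman_modulus p \<alpha> \<delta> g"
  have \<delta>: "\<delta> > 0" and c: "c \<ge> 0" using assms(6) by (auto simp: \<delta>_def c_def)
  define a where "a m = (deriv ^^ m) f 0 / fact m" for m
  have f: "power_series a f"
    unfolding power_series_def a_def using holomorphic_power_series[OF assms(3)] by auto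
  have g: "power_series (\<lambda>m. (\<i> * of_nat m) ^ K * a m) g"
    unfolding g_def by (rule power_series_angular_deriv[OF f])
  have rot: "bergman_le p \<alpha> \<omega> (\<lambda>z. g (cis t * z) - g z)" if "0 \<le> t" "t \<le> \<delta>" for t
    unfolding \<omega>_def using assms(1,5) that by (intro bergman_modulus_upper) (auto simp: g_def)
  have \<omega>: "0 \<le> \<omega>" using rot[of 0] \<delta> unfolding bergman_le_def by auto
  have phi: "phi (c * real m) = 0" if "n \<le> m" for m
    using that assms(6) by (intro phi_eq_0) (simp add: c_def field_simps)
  \<comment> \<open>Error for the mean of \<open>f\<close>. Its derivative of order K + 1 is the
    difference quotient of \<open>g\<close> with step \<delta>; the factor \<delta> is kept on the
    coefficients and divided out at the end.\<close>
  have smooth: "\<exists>e. bergman_le p \<alpha> (c ^ Suc K * C (Suc K) * \<omega> / \<delta>) e \<and>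
      power_series (\<lambda>m. of_real (1 - phi (c * real m)) * (mean_coeff \<delta> m * a m)) e"
  proof -
    have "power_series (\<lambda>m. (\<i> * of_nat m) ^ K * a m * cis (real m * \<delta>) - (\<i> * of_nat m) ^ K * a m)
        (\<lambda>z. g (cis \<delta> * z) - g z)"
      by (intro power_series_diff power_series_rotate g)
    moreover have "(\<i> * of_nat m) ^ K * a m * cis (real m * \<delta>) - (\<i> * of_nat m) ^ K * a m
        = (\<i> * of_nat m) ^ Suc K * (\<delta> * (mean_coeff \<delta> m * a m))" for m
    proof -
      have "(\<i> * of_nat m) ^ Suc K * (\<delta> * (mean_coeff \<delta> m * a m))
          = (\<i> * of_nat m) ^ K * a m * (\<delta> * (\<i> * of_nat m * mean_coeff \<delta> m))"
        by (simp only: power_Suc mult_ac)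
      also have "\<dots> = (\<i> * of_nat m) ^ K * a m * (cis (real m * \<delta>) - 1)"
        unfolding mean_coeff[OF \<delta>] using \<delta> by simp
      finally show ?thesis by (simp add: right_diff_distrib)
    qed
    ultimately have "power_series (\<lambda>m. (\<i> * of_nat m) ^ Suc K * (\<delta> * (mean_coeff \<delta> m * a m)))
        (\<lambda>z. g (cis \<delta> * z) - g z)" by simp
    from approximation_error[OF assms(1) c rot[OF less_imp_le[OF \<delta>] order_refl] this]
    obtain e where e: "bergman_le p \<alpha> (c ^ Suc K * C (Suc K) * \<omega>) e"
        "power_series (\<lambda>m. of_real (1 - phi (c * real m)) * (\<delta> * (mean_coeff \<delta> m * a m))) e"
      by blast
    have "power_series (\<lambda>m. of_real (1 / \<delta>) * (of_real (1 - phi (c * real m)) * (\<delta> * (mean_coeff \<delta> m * a m))))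
        (\<lambda>z. of_real (1 / \<delta>) * e z)"
      by (rule power_series_cmult[OF e(2)])
    moreover have "of_real (1 / \<delta>) * (of_real (1 - phi (c * real m)) * (\<delta> * (mean_coeff \<delta> m * a m)))
        = of_real (1 - phi (c * real m)) * (mean_coeff \<delta> m * a m)" for m
      using \<delta> by simp
    ultimately show ?thesis
      using bergman_le_cmult[OF e(1), of "of_real (1 / \<delta>)"] \<delta> by (auto simp: norm_divide mult_ac)
  qed
  then obtain e where e: "bergman_le p \<alpha> (c ^ Suc K * C (Suc K) * \<omega> / \<delta>) e"
      "power_series (\<lambda>m. of_real (1 - phi (c * real m)) * (mean_coeff \<delta> m * a m)) e" by blast
  \<comment> \<open>\<open>w\<close> is the K-th angular derivative of the remainder,
    \<open>f\<close> minus its mean.\<close>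
  obtain w where w: "bergman_le p \<alpha> \<omega> w"
      "power_series (\<lambda>m. (1 - mean_coeff \<delta> m) * ((\<i> * of_nat m) ^ K * a m)) w"
    using mean_difference[OF assms(1) \<delta> g rot] by blast
  \<comment> \<open>\<open>approximation_error\<close> covers orders from 1 on, so K = 0 takes
    \<open>w\<close> itself as the error. The two cases differ in the low coefficients, hence only
    those from \<open>n\<close> on are specified.\<close>
  have "\<exists>e' b'. bergman_le p \<alpha> (c ^ K * C K * \<omega>) e' \<and> power_series b' e' \<and>
      (\<forall>m\<ge>n. b' m = (1 - mean_coeff \<delta> m) * a m)"
  proof (cases K)
    case 0
    have "bergman_le p \<alpha> (c ^ K * C K * \<omega>) w"
      using w(1) by (rule bergman_le_mono)
         (use 0 \<omega> C_0_ge_1 assms(1) in \<open>auto simp: mult_le_cancel_right1 simp del: H.simps\<close>)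
    then show ?thesis using w(2) 0 by auto
  next
    case (Suc k)
    have "power_series (\<lambda>m. (\<i> * of_nat m) ^ Suc k * ((1 - mean_coeff \<delta> m) * a m)) w"
      using w(2) unfolding Suc by (simp only: mult_ac)
    from approximation_error[OF assms(1) c w(1) this] obtain e'
      where "bergman_le p \<alpha> (c ^ K * C K * \<omega>) e'"
        and "power_series (\<lambda>m. of_real (1 - phi (c * real m)) * ((1 - mean_coeff \<delta> m) * a m)) e'"
      unfolding Suc by blast
    then show ?thesis
      using phi by (intro exI conjI) auto
  qed
  then obtain e' b' where e': "bergman_le p \<alpha> (c ^ K * C K * \<omega>) e'" "power_series b' e'"
    and b': "\<And>m. m \<ge> n \<Longrightarrow> b' m = (1 - mean_coeff \<delta> m) * a m" by blast
  \<comment> \<open>From \<open>n\<close> on \<open>phi\<close> vanishes, and the coefficients of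
    mean and remainder add up to those of \<open>f\<close>.\<close>
  have "best_approx p \<alpha> n f \<le> c ^ Suc K * C (Suc K) * \<omega> / \<delta> + c ^ K * C K * \<omega>"
    by (rule best_approx_le[OF assms(1) f e(2,1) e'(2,1)]) (simp add: phi b' algebra_simps)
  \<comment> \<open>Here c/\<delta> = 1/pi and c^K = 2^K/n^K.\<close>
  also have "c ^ Suc K * C (Suc K) * \<omega> / \<delta> + c ^ K * C K * \<omega> = B K * \<omega> / real n ^ K"
    using assms(6) by (simp add: c_def \<delta>_def B_def power_divide field_simps)
  finally show ?thesis
    unfolding \<omega>_def \<delta>_def g_def .
qed

end
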